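(* Fix $T>0$, $N,m,d\in\mathbb N$, a Lipschitz control $x:[0,T]\to\mathbb R^d$, an initial value $S_0\in\mathbf 1+\mathfrak t^N(\mathbb R^m)$, and let $F:\mathbf 1+\mathfrak t^N(\mathbb R^m)\to L(\mathbb R^d,\mathfrak t^N(\mathbb R^m))$ be continuous, with columns $F^j:\mathbf 1+\mathfrak t^N(\mathbb R^m)\to\mathfrak t^N(\mathbb R^m)$. Consider the equation $$\mathrm dS_t=\sum_{j=1}^dS_t\otimes_NF^j(S_t)\,\mathrm dx^j_t,\qquad S_0\in\mathbf 1+\mathfrak t^N(\mathbb R^m).\qquad( * )$$ (a) If there is $C_F>0$ such that $\|F^j(\mathbf a)\|_h\le C_F(1+\|\mathbf a\|_h)$ for all $\mathbf a\in\mathbf 1+\mathfrak t^N(\mathbb R^m)$ and all $j\in\{1,\dots,d\}$, then $( * )$ admits a global solution (i.e. on $[0,T]$). (b) Alternatively, if $F$ is level-wise triangular and there is $C_F>0$ such that $$|F^j_{[n]}(\mathbf a)|\le C_F\big(1+\|\pi_{0,n}(\mathbf a)\|_h\big)$$ for all $\mathbf a\in\mathbf 1+\mathfrak t^N(\mathbb R^m)$, $j\in\{1,\dots,d\}$ and $n\in\{1,\dots,N\}$, then $( * )$ again admits a global solution.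
   Context: $T^N(\mathbb R^m)=\bigoplus_{n=0}^N(\mathbb R^m)^{\otimes n}$ with truncated tensor product $\otimes_N$ and Euclidean norm $|\cdot|$; elements are $\mathbf a=(\mathbf a^{(0)},\dots,\mathbf a^{(N)})$; $\pi_{0,n}$ is truncation to levels $0,\dots,n$. $\mathfrak t^N(\mathbb R^m)=\{\mathbf a:\mathbf a^{(0)}=0\}$ is a Lie algebra (commutator bracket) and $\mathbf 1+\mathfrak t^N(\mathbb R^m)=\{\mathbf a:\mathbf a^{(0)}=1\}$ its Lie group under $\otimes_N$; the truncated tensor exponential $\exp_{\otimes N}:\mathfrak t^N(\mathbb R^m)\to\mathbf 1+\mathfrak t^N(\mathbb R^m)$ is a global diffeomorphism with inverse $\log_{\otimes N}$. Dilations: $(\delta_\lambda\mathbf a)^{(n)}=\lambda^n\mathbf a^{(n)}$. A homogeneous gauge on $\mathbf 1+\mathfrak t^n(\mathbb R^m)$ is a continuous $\|\cdot\|_h:\mathbf 1+\mathfrak t^n(\mathbb R^m)\to[0,\infty)$ with $\|\mathbf g\|_h=0$ iff $\mathbf g=\mathbf 1$, $\|\mathbf g^{-1}\|_h=\|\mathbf g\|_h$ and $\|\delta_\lambda\mathbf g\|_h=\lambda\|\mathbf g\|_h$ for $\lambda>0$; all homogeneous gauges are equivalent, so the choice is immaterial. For $\Omega\in\mathfrak t^n(\mathbb R^m)$ set $\|\Omega\|_h:=\|\exp_{\otimes n}(\Omega)\|_h$; for $\mathbf a\in\mathbf 1+\mathfrak t^N(\mathbb R^m)$, $\|\pi_{0,n}(\mathbf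 a)\|_h$ is a gauge on $\mathbf 1+\mathfrak t^n(\mathbb R^m)$ evaluated at $\pi_{0,n}(\mathbf a)$. $F^j_{[n]}(\mathbf a)\in(\mathbb R^m)^{\otimes n}$ is the level-$n$ component of $F^j(\mathbf a)$. $F$ is level-wise triangular if for all $j$ and all $n\in\{1,\dots,N\}$, $F^j_{[n]}(\mathbf a)$ depends only on $(\mathbf a^{(1)},\dots,\mathbf a^{(n)})$. A solution of $( * )$ on an interval is a continuous path $S$ with values in $\mathbf 1+\mathfrak t^N(\mathbb R^m)$ satisfying the corresponding Riemann–Stieltjes integral equation (equivalently, $\Omega=\log_{\otimes N}S$ solves the equation obtained by taking logarithms). *)

theory Defs
  imports "HOL-Analysis.Analysis"
begin

text \<open>
  A tensor over \<open>\<real>\<^sup>m\<close> is given by its coordinates in the standard basis: the basis vectors of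
  the \<open>n\<close>-th tensor power are indexed by the words of length \<open>n\<close> over an \<open>m\<close>-element index type
  \<open>'m\<close>. The type below is the full tensor algebra (finitely supported coordinates), with
  the Euclidean inner product; the truncated spaces for the various levels \<open>N\<close> are subspaces of
  it. Each of these is finite-dimensional, so its subspace topology is the usual Euclidean one.
\<close>

typedef 'm tensor = "{f :: 'm list \<Rightarrow> real. finite {w. f w \<noteq> 0}}"
  morphisms tcoeff Tensor
  by (rule exI[of _ "\<lambda>_. 0"]) simp

setup_lifting type_definition_tensor

lemma finite_tcoeff: "finite {w. tcoeff a w \<noteq> 0}"
  using tcoeff[of a] by simp

lemma tensor_eqI: "(\<And>w. tcoeff a w = tcoeff b w) \<Longrightarrow> a = b"
  by (metis ext tcoeff_inject)

instantiation tensor :: (type) real_vector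
begin

lift_definition zero_tensor :: "'a tensor" is "\<lambda>_. 0" by simp

lift_definition plus_tensor :: "'a tensor \<Rightarrow> 'a tensor \<Rightarrow> 'a tensor" is "\<lambda>f g w. f w + g w"
proof -
  fix f g :: "'a list \<Rightarrow> real"
  assume "finite {w. f w \<noteq> 0}" "finite {w. g w \<noteq> 0}"
  then show "finite {w. f w + g w \<noteq> 0}"
    by (rule finite_subset[rotated, OF finite_UnI]) auto
qed

lift_definition uminus_tensor :: "'a tensor \<Rightarrow> 'a tensor" is "\<lambda>f w. - f w" by simp

lift_definition minus_tensor :: "'a tensor \<Rightarrow> 'a tensor \<Rightarrow> 'a tensor" is "\<lambda>f g w. f w - g w"
proof -
  fix f g :: "'a list \<Rightarrow> real"
  assume "finite {w. f w \<noteq> 0}" "finite {w. g w \<noteq> 0}"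
  then show "finite {w. f w - g w \<noteq> 0}"
    by (rule finite_subset[rotated, OF finite_UnI]) auto
qed

lift_definition scaleR_tensor :: "real \<Rightarrow> 'a tensor \<Rightarrow> 'a tensor" is "\<lambda>c f w. c * f w" by simp

instance
  by standard (rule tensor_eqI; transfer; simp add: algebra_simps)+

end

lemma tcoeff_simps [simp]:
  "tcoeff 0 w = 0"
  "tcoeff (a + b) w = tcoeff a w + tcoeff b w"
  "tcoeff (a - b) w = tcoeff a w - tcoeff b w"
  "tcoeff (- a) w = - tcoeff a w"
  "tcoeff (c *\<^sub>R a) w = c * tcoeff a w"
  by (transfer; simp)+

definition tensor_inner :: "'m tensor \<Rightarrow> 'm tensor \<Rightarrow> real" where
  "tensor_inner a b = (\<Sum>w | tcoeff a w \<noteq> 0. tcoeff a w * tcoeff b w)"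

lemma tensor_inner_superset:
  assumes "finite A" "{w. tcoeff a w \<noteq> 0} \<subseteq> A"
  shows "tensor_inner a b = (\<Sum>w\<in>A. tcoeff a w * tcoeff b w)"
  unfolding tensor_inner_def using assms by (intro sum.mono_neutral_left) auto

instantiation tensor :: (type) real_inner
begin

definition "inner (a :: 'a tensor) b = tensor_inner a b"

definition "norm (a :: 'a tensor) = sqrt (inner a a)"

definition "dist (a :: 'a tensor) b = norm (a - b)"

definition "sgn (a :: 'a tensor) = a /\<^sub>R norm a"

definition [code del]:
  "(uniformity :: ('a tensor \<times> 'a tensor) filter) = (INF e\<in>{0 <..}. principal {(a, b). dist a b < e})"

definition [code del]:
  "open (U :: 'a tensor set) \<longleftrightarrow> (\<forall>a\<in>U. eventually (\<lambda>(a', b). a' = a \<longrightarrow> b \<in> U) uniformity)"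

instance
proof
  fix a b c :: "'a tensor" and r :: real
  let ?A = "{w. tcoeff a w \<noteq> 0} \<union> {w. tcoeff b w \<noteq> 0} \<union> {w. tcoeff c w \<noteq> 0}"
  have fin: "finite ?A" by (simp add: finite_tcoeff)
  have eq: "inner p q = (\<Sum>w\<in>?A. tcoeff p w * tcoeff q w)"
    if "{w. tcoeff p w \<noteq> 0} \<subseteq> ?A" for p q
    unfolding inner_tensor_def using tensor_inner_superset[OF fin that] .
  show "inner a b = inner b a"
    by (subst (1 2) eq) (auto simp: mult.commute)
  show "inner (a + b) c = inner a c + inner b c"
    by (subst (1 2 3) eq) (auto simp: sum.distrib[symmetric] distrib_right)
  show "inner (r *\<^sub>R a) b = r * inner a b"
    by (subst (1 2) eq) (auto simp: sum_distrib_left mult.assoc)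
  show "0 \<le> inner a a"
    unfolding inner_tensor_def tensor_inner_def by (intro sum_nonneg) auto
  show "inner a a = 0 \<longleftrightarrow> a = 0"
  proof
    assume "inner a a = 0"
    then have "\<forall>w\<in>{w. tcoeff a w \<noteq> 0}. tcoeff a w * tcoeff a w = 0"
      unfolding inner_tensor_def tensor_inner_def
      by (subst (asm) sum_nonneg_eq_0_iff) (auto simp: finite_tcoeff)
    then show "a = 0" by (intro tensor_eqI) auto
  next
    assume "a = 0"
    then show "inner a a = 0" by (simp add: inner_tensor_def tensor_inner_def)
  qed
qed (rule dist_tensor_def sgn_tensor_def uniformity_tensor_def open_tensor_def norm_tensor_def)+

end

text \<open>The component of level \<open>n\<close>, regarded as an element of the tensor algebra.\<close>

lift_definition level :: "nat \<Rightarrow> 'm tensor \<Rightarrow> 'm tensor"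
  is "\<lambda>n f w. if length w = n then f w else 0"
  by (erule finite_subset[rotated]) auto

definition trunc :: "nat \<Rightarrow> 'm tensor \<Rightarrow> 'm tensor" where
  "trunc n a = (\<Sum>k\<le>n. level k a)"

definition trunc_tensors :: "nat \<Rightarrow> 'm tensor set" where
  "trunc_tensors N = {a. \<forall>n>N. level n a = 0}"

definition lie_alg :: "nat \<Rightarrow> 'm tensor set" where
  "lie_alg N = {a \<in> trunc_tensors N. tcoeff a [] = 0}"

definition lie_grp :: "nat \<Rightarrow> 'm tensor set" where
  "lie_grp N = {a \<in> trunc_tensors N. tcoeff a [] = 1}"

lift_definition tone :: "'m tensor" is "\<lambda>w. if w = [] then 1 else 0"
  by (rule finite_subset[of _ "{[]}"]) auto

text \<open>The tensor product concatenates basis words, hence a coordinate of the product is a sum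
  over all splittings of the word.\<close>

lift_definition tmult :: "nat \<Rightarrow> 'm::finite tensor \<Rightarrow> 'm tensor \<Rightarrow> 'm tensor"
  is "\<lambda>N f g w. if length w \<le> N then \<Sum>k\<le>length w. f (take k w) * g (drop k w) else 0"
proof -
  fix N and f g :: "'m list \<Rightarrow> real"
  have "finite {w :: 'm list. length w \<le> N}"
    using finite_lists_length_le[of "UNIV :: 'm set" N] by simp
  then show "finite {w. (if length w \<le> N then \<Sum>k\<le>length w. f (take k w) * g (drop k w) else 0) \<noteq> 0}"
    by (rule finite_subset[rotated]) auto
qed

fun tpow :: "nat \<Rightarrow> 'm::finite tensor \<Rightarrow> nat \<Rightarrow> 'm tensor" where
  "tpow N a 0 = tone"
| "tpow N a (Suc k) = tmult N a (tpow N a k)"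

text \<open>For \<open>a\<close> in the Lie algebra the powers of exponent larger than \<open>N\<close> vanish.\<close>

definition texp :: "nat \<Rightarrow> 'm::finite tensor \<Rightarrow> 'm tensor" where
  "texp N a = (\<Sum>k\<le>N. (1 / fact k) *\<^sub>R tpow N a k)"

lift_definition dilation :: "real \<Rightarrow> 'm tensor \<Rightarrow> 'm tensor"
  is "\<lambda>c f w. c ^ length w * f w"
  by (erule finite_subset[rotated]) auto

text \<open>Invariance under inversion is stated for every two-sided inverse \<open>g'\<close> of \<open>g\<close> in the group;
  inverses exist and are unique there.\<close>

definition homogeneous_gauge :: "nat \<Rightarrow> ('m::finite tensor \<Rightarrow> real) \<Rightarrow> bool" where
  "homogeneous_gauge n h \<longleftrightarrow>
     continuous_on (lie_grp n) h \<and>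
     (\<forall>g\<in>lie_grp n. 0 \<le> h g) \<and>
     (\<forall>g\<in>lie_grp n. h g = 0 \<longleftrightarrow> g = tone) \<and>
     (\<forall>g\<in>lie_grp n. \<forall>g'\<in>lie_grp n. tmult n g g' = tone \<and> tmult n g' g = tone \<longrightarrow> h g' = h g) \<and>
     (\<forall>g\<in>lie_grp n. \<forall>c>0. h (dilation c g) = c * h g)"

definition lie_gauge :: "nat \<Rightarrow> ('m::finite tensor \<Rightarrow> real) \<Rightarrow> 'm tensor \<Rightarrow> real" where
  "lie_gauge n h \<Omega> = h (texp n \<Omega>)"

text \<open>Riemann--Stieltjes integral of \<open>f\<close> against \<open>g\<close>, as a limit when the mesh tends to zero;
  degenerate intervals in a tagged division contribute nothing to the sums.\<close>

definition has_rs_integral ::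
    "(real \<Rightarrow> 'a::real_normed_vector) \<Rightarrow> (real \<Rightarrow> real) \<Rightarrow> 'a \<Rightarrow> real \<Rightarrow> real \<Rightarrow> bool" where
  "has_rs_integral f g I a b \<longleftrightarrow>
     (\<forall>e>0. \<exists>d>0. \<forall>p. p tagged_division_of {a..b} \<and> (\<forall>(\<xi>, K)\<in>p. diameter K < d) \<longrightarrow>
        norm ((\<Sum>(\<xi>, K)\<in>p. (g (Sup K) - g (Inf K)) *\<^sub>R f \<xi>) - I) < e)"

definition blinfun_column ::
    "('a \<Rightarrow> (real ^ 'd) \<Rightarrow>\<^sub>L 'b::real_normed_vector) \<Rightarrow> 'd \<Rightarrow> 'a \<Rightarrow> 'b" where
  "blinfun_column F j a = blinfun_apply (F a) (axis j 1)"

definition cde_solution ::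
    "nat \<Rightarrow> ('m::finite tensor \<Rightarrow> (real ^ 'd) \<Rightarrow>\<^sub>L 'm tensor) \<Rightarrow> (real \<Rightarrow> real ^ 'd) \<Rightarrow> 'm tensor
      \<Rightarrow> real \<Rightarrow> (real \<Rightarrow> 'm tensor) \<Rightarrow> bool" where
  "cde_solution N F x S0 T S \<longleftrightarrow>
     continuous_on {0..T} S \<and>
     (\<forall>t\<in>{0..T}. S t \<in> lie_grp N) \<and>
     (\<forall>t\<in>{0..T}. \<exists>I. (\<forall>j. has_rs_integral (\<lambda>s. tmult N (S s) (blinfun_column F j (S s)))
                                             (\<lambda>s. x s $ j) (I j) 0 t) \<and>
                      S t = S0 + (\<Sum>j\<in>UNIV. I j))"

definition levelwise_triangular ::
    "nat \<Rightarrow> ('m::finite tensor \<Rightarrow> (real ^ 'd) \<Rightarrow>\<^sub>L 'm tensor) \<Rightarrow> bool" where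
  "levelwise_triangular N F \<longleftrightarrow>
     (\<forall>j. \<forall>n\<in>{1..N}. \<forall>a\<in>lie_grp N. \<forall>b\<in>lie_grp N.
        (\<forall>k\<in>{1..n}. level k a = level k b) \<longrightarrow>
        level n (blinfun_column F j a) = level n (blinfun_column F j b))"

end

theory Submission
  imports Defs "HOL-Complex_Analysis.Great_Picard"
begin

text \<open>
  Let \<open>\<rho>\<close> be the explicit homogeneous norm \<open>hnorm\<close>. Compactness of its unit spheres and scaling by
  dilations give \<open>h \<le> C \<rho>\<close> on the group for every homogeneous gauge \<open>h\<close>, and \<open>\<rho> \<le> C (h \<circ> exp)\<close> on the
  Lie algebra. Both growth hypotheses therefore imply that the coordinate of \<open>F\<^sup>j(a)\<close> at a word of
  length \<open>n \<ge> 1\<close> is bounded by \<open>D (1 + \<rho>(a))\<^sup>n\<close>, and then so is that of \<open>a \<otimes> F\<^sup>j(a)\<close>: along the equation,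
  every coordinate changes at most at the rate prescribed by its homogeneity. Hence the
  polynomial \<open>W = 1 + \<rho>\<^sup>M\<close>, \<open>M = 2 N!\<close>, is multiplied by at most \<open>1 + c |v|\<close> in an Euler step with
  increment \<open>v\<close> of the control. The Euler polygons thus stay in a fixed compact set up to time \<open>T\<close> and
  are uniformly Lipschitz; a limit provided by the Arzela--Ascoli theorem solves the equation.
\<close>

text \<open>In the Euclidean norm the field may grow superlinearly, because \<open>tmult\<close>
  multiplies coordinates of \<open>a\<close> with coordinates of the columns of \<open>F\<close>; an
  ordinary Gronwall estimate therefore does not exclude explosion. Weighting coordinates by level
  repairs this. Put \<open>R = root M (1 + hsum N a)\<close> with \<open>M = hdeg N\<close>: at a
  word of length \<open>n\<close> both the coordinate and its rate of change are
  O(\<open>R ^ n\<close>), since word lengths add up in a product, so the power \<open>M / n\<close>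
  of that coordinate changes at rate O(\<open>R ^ M\<close>), which is linear in \<open>W\<close>.
  As \<open>F\<close> is merely continuous, existence has to come from compactness. The group is an
  affine space over the Lie algebra, so an explicit Euler step never leaves it and the estimates can
  be made directly in tensor coordinates. The type \<open>tensor\<close> contains all levels at once
  and is infinite-dimensional and incomplete. Compactness and primitives are therefore obtained
  through the finitely many coordinates indexed by \<open>words N\<close>, and the general lemmas
  take an expansion along a finite set \<open>B\<close> as hypothesis.\<close>

section \<open>Riemann--Stieltjes integrals against Lipschitz integrators\<close>

text \<open>An additive primitive whose increments are compared with single terms of a Riemann--Stieltjes
  sum: the difference of the integral and any sum then telescopes, over tagged divisions as well as
  over Euler grids.\<close>

definition rs_primitive ::
    "(real \<Rightarrow> 'a::real_normed_vector) \<Rightarrow> (real \<Rightarrow> real) \<Rightarrow> (real \<Rightarrow> 'a) \<Rightarrow> real \<Rightarrow> real \<Rightarrow> bool" where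
  "rs_primitive f g \<Phi> a b \<longleftrightarrow>
     (\<forall>e>0. \<exists>\<delta>>0. \<forall>c \<xi> d. a \<le> c \<and> c \<le> \<xi> \<and> \<xi> \<le> d \<and> d \<le> b \<and> d - c < \<delta> \<longrightarrow>
        norm (\<Phi> d - \<Phi> c - (g d - g c) *\<^sub>R f \<xi>) \<le> e * (d - c))"

lemma rs_primitiveD:
  assumes "rs_primitive f g \<Phi> a b" "0 < e"
  obtains \<delta> where "0 < \<delta>"
    "\<And>c \<xi> d. a \<le> c \<Longrightarrow> c \<le> \<xi> \<Longrightarrow> \<xi> \<le> d \<Longrightarrow> d \<le> b \<Longrightarrow> d - c < \<delta> \<Longrightarrow>
       norm (\<Phi> d - \<Phi> c - (g d - g c) *\<^sub>R f \<xi>) \<le> e * (d - c)"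
  using assms unfolding rs_primitive_def by meson

lemma rs_primitive_imp_has_rs_integral:
  assumes prim: "rs_primitive f g \<Phi> a b" and t: "a \<le> t" "t \<le> b"
  shows "has_rs_integral f g (\<Phi> t - \<Phi> a) a t"
  unfolding has_rs_integral_def
proof (intro allI impI)
  fix e :: real assume "0 < e"
  \<comment> \<open>The summand 1 keeps the denominator positive when \<open>t = a\<close>.\<close>
  define e' where "e' = e / (2 * (t - a + 1))"
  have "e * (t - a) < e * (2 * (t - a + 1))"
    using \<open>0 < e\<close> t by (intro mult_strict_left_mono) auto
  then have e': "0 < e'" "e' * (t - a) < e"
    using \<open>0 < e\<close> t by (auto simp: e'_def divide_less_eq)
  obtain \<delta> where "0 < \<delta>" and \<delta>:
    "\<And>c \<xi> d. a \<le> c \<Longrightarrow> c \<le> \<xi> \<Longrightarrow> \<xi> \<le> d \<Longrightarrow> d \<le> b \<Longrightarrow> d - c < \<delta> \<Longrightarrow>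
       norm (\<Phi> d - \<Phi> c - (g d - g c) *\<^sub>R f \<xi>) \<le> e' * (d - c)"
    using rs_primitiveD[OF prim e'(1)] by metis
  have "norm ((\<Sum>(\<xi>, K)\<in>p. (g (Sup K) - g (Inf K)) *\<^sub>R f \<xi>) - (\<Phi> t - \<Phi> a)) < e"
    if p: "p tagged_division_of {a..t}" and fine: "\<forall>(\<xi>, K)\<in>p. diameter K < \<delta>" for p
  proof -
    have sum_diff: "(\<Sum>(\<xi>, K)\<in>p. \<psi> (Sup K) - \<psi> (Inf K)) = \<psi> t - \<psi> a"
      for \<psi> :: "real \<Rightarrow> 'c::real_normed_vector"
      using additive_tagged_division_1[OF t(1) p, of \<psi>] .
    have err: "norm ((g (Sup K) - g (Inf K)) *\<^sub>R f \<xi> - (\<Phi> (Sup K) - \<Phi> (Inf K))) \<le> e' * (Sup K - Inf K)"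
      if K: "(\<xi>, K) \<in> p" for \<xi> K
    proof -
      obtain c d where cd: "K = {c..d}"
        using tagged_division_ofD(4)[OF p K] by (auto simp: cbox_interval)
      \<comment> \<open>The tag makes \<open>K\<close> nonempty; otherwise the inclusion below would
        say nothing about the endpoints.\<close>
      have mem: "c \<le> \<xi>" "\<xi> \<le> d" using tagged_division_ofD(2)[OF p K] cd by auto
      have "{c..d} \<subseteq> {a..t}" using tagged_division_ofD(3)[OF p K] cd by simp
      then have "a \<le> c" "d \<le> t" using mem by auto
      moreover have "d - c < \<delta>"
        using bspec[OF fine K] mem by (simp add: cd)
      ultimately show ?thesis
        using \<delta>[of c \<xi> d] mem t(2) by (simp add: cd norm_minus_commute)
    qed
    have "norm ((\<Sum>(\<xi>, K)\<in>p. (g (Sup K) - g (Inf K)) *\<^sub>R f \<xi>) - (\<Phi> t - \<Phi> a))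
        = norm (\<Sum>(\<xi>, K)\<in>p. (g (Sup K) - g (Inf K)) *\<^sub>R f \<xi> - (\<Phi> (Sup K) - \<Phi> (Inf K)))"
      by (simp flip: sum_diff add: sum_subtractf split_def)
    also have "\<dots> \<le> (\<Sum>(\<xi>, K)\<in>p. e' * (Sup K - Inf K))"
      using err by (intro sum_norm_le) auto
    also have "\<dots> = e' * (t - a)"
      using sum_diff[of "\<lambda>s. s"] by (simp add: split_def flip: sum_distrib_left)
    also have "\<dots> < e" by (rule e'(2))
    finally show ?thesis .
  qed
  with \<open>0 < \<delta>\<close> show "\<exists>d>0. \<forall>p. p tagged_division_of {a..t} \<and> (\<forall>(\<xi>, K)\<in>p. diameter K < d) \<longrightarrow>
      norm ((\<Sum>(\<xi>, K)\<in>p. (g (Sup K) - g (Inf K)) *\<^sub>R f \<xi>) - (\<Phi> t - \<Phi> a)) < e"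
    by blast
qed

text \<open>\<open>\<Phi>\<close> is the Lebesgue-Stieltjes integral of \<open>f\<close> over
  \<open>(a, s]\<close>; half-open intervals make it exactly additive. An increment differs from a
  Riemann-Stieltjes term by the integral of \<open>f r - f \<xi>\<close>, which uniform continuity
  of \<open>f\<close> bounds by \<open>e'\<close> times the mass of \<open>(c, d]\<close>, and this
  mass is at most \<open>L * (d - c)\<close>.\<close>

lemma rs_primitive_exists_mono:
  fixes f g :: "real \<Rightarrow> real"
  assumes f: "continuous_on {a..b} f" and g: "mono g" "L-lipschitz_on UNIV g"
  shows "\<exists>\<Phi>. rs_primitive f g \<Phi> a b"
proof -
  define M where "M = interval_measure g"
  have gcont: "continuous_on UNIV g" using g(2) by (rule lipschitz_on_continuous_on)
  have meas: "emeasure M {c<..d} = ennreal (g d - g c)" if "c \<le> d" for c d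
    unfolding M_def using that gcont monoD[OF g(1)]
    by (intro emeasure_interval_measure_Ioc)
       (auto intro: continuous_within_subset simp: continuous_on_eq_continuous_within)
  have meas': "measure M {c<..d} = g d - g c" if "c \<le> d" for c d
    using meas[OF that] monoD[OF g(1) that] by (simp add: measure_def)
  have L: "0 \<le> L" using g(2) by (rule lipschitz_on_nonneg)
  \<comment> \<open>Cutting \<open>f\<close> off outside \<open>{a..b}\<close> gives a function that
    is measurable on the whole line.\<close>
  define f' where "f' = (\<lambda>s. indicator {a..b} s *\<^sub>R f s)"
  have f'_meas: "f' \<in> borel_measurable M"
    unfolding M_def f'_def using borel_measurable_continuous_on_indicator[OF _ f] by simp
  have "bounded (f ` {a..b})"
    using f by (intro compact_imp_bounded compact_continuous_image) auto
  then obtain B where B: "\<And>s. s \<in> {a..b} \<Longrightarrow> norm (f s) \<le> B"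
    unfolding bounded_iff by blast
  have f'_int: "set_integrable M {c<..d} f'" if "c \<le> d" for c d
    unfolding set_integrable_def
    using f'_meas meas[OF that] B
    by (intro integrableI_bounded_set_indicator[where B="max 0 B"])
       (auto simp: M_def f'_def indicator_def le_max_iff_disj)
  define \<Phi> where "\<Phi> = (\<lambda>s. LINT r:{a<..s}|M. f' r)"
  have \<Phi>: "\<Phi> d - \<Phi> c = (LINT r:{c<..d}|M. f' r)" if "a \<le> c" "c \<le> d" for c d
  proof -
    have "{a<..d} = {a<..c} \<union> {c<..d}" "{a<..c} \<inter> {c<..d} = {}" using that by auto
    then show ?thesis
      unfolding \<Phi>_def using set_integral_Un[of "{a<..c}" "{c<..d}" M f'] f'_int that by simp
  qed
  have "\<exists>\<delta>>0. \<forall>c \<xi> d. a \<le> c \<and> c \<le> \<xi> \<and> \<xi> \<le> d \<and> d \<le> b \<and> d - c < \<delta> \<longrightarrow>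
        norm (\<Phi> d - \<Phi> c - (g d - g c) *\<^sub>R f \<xi>) \<le> e * (d - c)" if "0 < e" for e
  proof -
    define e' where "e' = e / (L + 1)"
    have e': "0 < e'" "e' * L \<le> e" using that L by (auto simp: e'_def field_simps)
    obtain \<delta> where "0 < \<delta>" and \<delta>: "\<And>r s. r \<in> {a..b} \<Longrightarrow> s \<in> {a..b} \<Longrightarrow> dist r s < \<delta> \<Longrightarrow> dist (f r) (f s) < e'"
      using compact_uniformly_continuous[OF f compact_Icc] e'(1)
      unfolding uniformly_continuous_on_def by metis
    have "norm (\<Phi> d - \<Phi> c - (g d - g c) *\<^sub>R f \<xi>) \<le> e * (d - c)"
      if h: "a \<le> c" "c \<le> \<xi>" "\<xi> \<le> d" "d \<le> b" "d - c < \<delta>" for c \<xi> d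
    proof -
      have cd: "c \<le> d" using h by simp
      have const_int: "set_integrable M {c<..d} (\<lambda>_. f \<xi>)"
        unfolding set_integrable_def using meas[OF cd] by (simp add: M_def)
      have "(g d - g c) *\<^sub>R f \<xi> = (LINT r:{c<..d}|M. f \<xi>)"
        using meas'[OF cd] meas[OF cd] by (simp add: set_lebesgue_integral_def M_def)
      then have "\<Phi> d - \<Phi> c - (g d - g c) *\<^sub>R f \<xi> = (LINT r:{c<..d}|M. f' r - f \<xi>)"
        using \<Phi>[OF h(1) cd] f'_int[OF cd] const_int by simp
      also have "norm \<dots> \<le> (LINT r:{c<..d}|M. norm (f' r - f \<xi>))"
        using f'_int[OF cd] const_int by (intro set_integral_norm_bound set_integral_diff(1))
      also have "\<dots> \<le> (LINT r:{c<..d}|M. e')"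
      proof (rule set_integral_mono)
        show "set_integrable M {c<..d} (\<lambda>r. norm (f' r - f \<xi>))"
          using f'_int[OF cd] const_int by (intro set_integrable_norm set_integral_diff(1))
        show "set_integrable M {c<..d} (\<lambda>_. e')"
          unfolding set_integrable_def using meas[OF cd] by (simp add: M_def)
        show "norm (f' r - f \<xi>) \<le> e'" if "r \<in> {c<..d}" for r
          using \<delta>[of r \<xi>] h that by (force simp: f'_def dist_real_def)
      qed
      also have "\<dots> = e' * (g d - g c)"
        using meas'[OF cd] meas[OF cd] by (simp add: set_lebesgue_integral_def M_def)
      also have "\<dots> \<le> e' * (L * (d - c))"
        using lipschitz_onD[OF g(2), of d c] e'(1) cd by (intro mult_left_mono) (auto simp: dist_real_def)
      also have "\<dots> \<le> e * (d - c)"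
        using e'(2) cd by (simp add: mult_right_mono flip: mult.assoc)
      finally show ?thesis .
    qed
    with \<open>0 < \<delta>\<close> show ?thesis by blast
  qed
  then have "rs_primitive f g \<Phi> a b" unfolding rs_primitive_def by blast
  then show ?thesis by blast
qed

lemma rs_primitive_diff_integrator:
  assumes "rs_primitive f g1 \<Phi>1 a b" "rs_primitive f g2 \<Phi>2 a b"
    and eq: "\<And>s. a \<le> s \<Longrightarrow> s \<le> b \<Longrightarrow> g s = g1 s - g2 s"
  shows "rs_primitive f g (\<lambda>s. \<Phi>1 s - \<Phi>2 s) a b"
  unfolding rs_primitive_def
proof (intro allI impI)
  fix e :: real assume "0 < e"
  then have e2: "0 < e / 2" by simp
  obtain \<delta>1 where \<delta>1: "0 < \<delta>1" "\<And>c \<xi> d. a \<le> c \<Longrightarrow> c \<le> \<xi> \<Longrightarrow> \<xi> \<le> d \<Longrightarrow> d \<le> b \<Longrightarrow> d - c < \<delta>1 \<Longrightarrow>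
       norm (\<Phi>1 d - \<Phi>1 c - (g1 d - g1 c) *\<^sub>R f \<xi>) \<le> e / 2 * (d - c)"
    using rs_primitiveD[OF assms(1) e2] by metis
  obtain \<delta>2 where \<delta>2: "0 < \<delta>2" "\<And>c \<xi> d. a \<le> c \<Longrightarrow> c \<le> \<xi> \<Longrightarrow> \<xi> \<le> d \<Longrightarrow> d \<le> b \<Longrightarrow> d - c < \<delta>2 \<Longrightarrow>
       norm (\<Phi>2 d - \<Phi>2 c - (g2 d - g2 c) *\<^sub>R f \<xi>) \<le> e / 2 * (d - c)"
    using rs_primitiveD[OF assms(2) e2] by metis
  have "norm (\<Phi>1 d - \<Phi>2 d - (\<Phi>1 c - \<Phi>2 c) - (g d - g c) *\<^sub>R f \<xi>) \<le> e * (d - c)"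
    if h: "a \<le> c" "c \<le> \<xi>" "\<xi> \<le> d" "d \<le> b" "d - c < min \<delta>1 \<delta>2" for c \<xi> d
  proof -
    have "\<Phi>1 d - \<Phi>2 d - (\<Phi>1 c - \<Phi>2 c) - (g d - g c) *\<^sub>R f \<xi> =
      (\<Phi>1 d - \<Phi>1 c - (g1 d - g1 c) *\<^sub>R f \<xi>) - (\<Phi>2 d - \<Phi>2 c - (g2 d - g2 c) *\<^sub>R f \<xi>)"
    proof -
      have "g d - g c = (g1 d - g1 c) - (g2 d - g2 c)"
        using eq[of c] eq[of d] h by simp
      then show ?thesis by (simp add: scaleR_diff_left)
    qed
    also have "norm \<dots> \<le> e / 2 * (d - c) + e / 2 * (d - c)"
      using \<delta>1(2)[of c \<xi> d] \<delta>2(2)[of c \<xi> d] h by (intro order_trans[OF norm_triangle_ineq4 add_mono]) auto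
    finally show ?thesis by simp
  qed
  with \<delta>1(1) \<delta>2(1) show "\<exists>\<delta>>0. \<forall>c \<xi> d. a \<le> c \<and> c \<le> \<xi> \<and> \<xi> \<le> d \<and> d \<le> b \<and> d - c < \<delta> \<longrightarrow>
        norm (\<Phi>1 d - \<Phi>2 d - (\<Phi>1 c - \<Phi>2 c) - (g d - g c) *\<^sub>R f \<xi>) \<le> e * (d - c)"
    by (intro exI[of _ "min \<delta>1 \<delta>2"]) auto
qed

lemma rs_primitive_exists_real:
  fixes f g :: "real \<Rightarrow> real"
  assumes ab: "a \<le> b" and f: "continuous_on {a..b} f" and g: "L-lipschitz_on {a..b} g"
  shows "\<exists>\<Phi>. rs_primitive f g \<Phi> a b"
proof -
  \<comment> \<open>\<open>g = g1 - g2\<close> on \<open>{a..b}\<close>, with both terms monotone and Lipschitz on the whole line\<close>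
  define g1 where "g1 = (\<lambda>s. g (max a (min b s)) + L * s)"
  define g2 where "g2 = (\<lambda>s :: real. L * s)"
  have L: "0 \<le> L" using g by (rule lipschitz_on_nonneg)
  have clamp: "\<bar>g (max a (min b r)) - g (max a (min b s))\<bar> \<le> L * \<bar>r - s\<bar>" for r s
  proof -
    have "dist (g (max a (min b r))) (g (max a (min b s))) \<le> L * dist (max a (min b r)) (max a (min b s))"
      using ab by (intro lipschitz_onD[OF g]) auto
    also have "\<dots> \<le> L * dist r s"
      using L by (intro mult_left_mono) (auto simp: dist_real_def)
    finally show ?thesis by (simp add: dist_real_def)
  qed
  \<comment> \<open>From \<open>r\<close> to \<open>s\<close> the clamped \<open>g\<close> drops by
    at most \<open>L * (s - r)\<close>, which the summand \<open>L * s\<close> makes up for.\<close>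
  have "mono g1"
  proof (rule monoI)
    fix r s :: real assume "r \<le> s"
    then show "g1 r \<le> g1 s"
      using clamp[of r s] by (auto simp: g1_def algebra_simps)
  qed
  moreover have "(2 * L)-lipschitz_on UNIV g1"
  proof (rule lipschitz_onI)
    fix r s
    have "dist (g1 r) (g1 s) \<le> \<bar>g (max a (min b r)) - g (max a (min b s))\<bar> + \<bar>L * (r - s)\<bar>"
      using abs_triangle_ineq[of "g (max a (min b r)) - g (max a (min b s))" "L * (r - s)"]
      by (simp add: g1_def dist_real_def algebra_simps)
    also have "\<dots> \<le> 2 * L * dist r s"
      using clamp[of r s] L by (simp add: abs_mult dist_real_def)
    finally show "dist (g1 r) (g1 s) \<le> 2 * L * dist r s" .
  qed (use L in simp)
  moreover have "mono g2" using L by (auto simp: g2_def mono_def mult_left_mono)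
  moreover have "L-lipschitz_on UNIV g2"
    using L by (intro lipschitz_onI) (auto simp: g2_def dist_real_def abs_mult simp flip: right_diff_distrib)
  ultimately obtain \<Phi>1 \<Phi>2 where "rs_primitive f g1 \<Phi>1 a b" "rs_primitive f g2 \<Phi>2 a b"
    using rs_primitive_exists_mono[OF f] by metis
  then have "rs_primitive f g (\<lambda>s. \<Phi>1 s - \<Phi>2 s) a b"
    by (rule rs_primitive_diff_integrator) (auto simp: g1_def g2_def)
  then show ?thesis by blast
qed

lemma rs_primitive_scaleR:
  assumes "rs_primitive f g \<Phi> a b"
  shows "rs_primitive (\<lambda>s. f s *\<^sub>R v) g (\<lambda>s. \<Phi> s *\<^sub>R v) a b"
  unfolding rs_primitive_def
proof (intro allI impI)
  fix e :: real assume "0 < e"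
  define e' where "e' = e / (norm v + 1)"
  have e': "0 < e'" "e' * norm v \<le> e" using \<open>0 < e\<close> by (auto simp: e'_def field_simps add_pos_nonneg)
  obtain \<delta> where \<delta>: "0 < \<delta>" "\<And>c \<xi> d. a \<le> c \<Longrightarrow> c \<le> \<xi> \<Longrightarrow> \<xi> \<le> d \<Longrightarrow> d \<le> b \<Longrightarrow> d - c < \<delta> \<Longrightarrow>
       norm (\<Phi> d - \<Phi> c - (g d - g c) *\<^sub>R f \<xi>) \<le> e' * (d - c)"
    using rs_primitiveD[OF assms e'(1)] by metis
  have "norm (\<Phi> d *\<^sub>R v - \<Phi> c *\<^sub>R v - (g d - g c) *\<^sub>R f \<xi> *\<^sub>R v) \<le> e * (d - c)"
    if h: "a \<le> c" "c \<le> \<xi>" "\<xi> \<le> d" "d \<le> b" "d - c < \<delta>" for c \<xi> d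
  proof -
    have "norm (\<Phi> d *\<^sub>R v - \<Phi> c *\<^sub>R v - (g d - g c) *\<^sub>R f \<xi> *\<^sub>R v)
        = norm (\<Phi> d - \<Phi> c - (g d - g c) *\<^sub>R f \<xi>) * norm v"
      by (simp flip: norm_scaleR scaleR_left_diff_distrib add: scaleR_scaleR)
    also have "\<dots> \<le> (e' * (d - c)) * norm v"
      using \<delta>(2)[of c \<xi> d] h by (intro mult_right_mono) auto
    also have "\<dots> \<le> e * (d - c)"
      using mult_right_mono[OF e'(2), of "d - c"] h by (simp add: mult_ac)
    finally show ?thesis .
  qed
  with \<delta>(1) show "\<exists>\<delta>>0. \<forall>c \<xi> d. a \<le> c \<and> c \<le> \<xi> \<and> \<xi> \<le> d \<and> d \<le> b \<and> d - c < \<delta> \<longrightarrow>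
      norm (\<Phi> d *\<^sub>R v - \<Phi> c *\<^sub>R v - (g d - g c) *\<^sub>R f \<xi> *\<^sub>R v) \<le> e * (d - c)"
    by blast
qed

lemma rs_primitive_0: "rs_primitive (\<lambda>_. 0) g (\<lambda>_. 0) a b"
  unfolding rs_primitive_def by (auto intro!: exI[of _ 1])

lemma rs_primitive_add:
  assumes "rs_primitive f1 g \<Phi>1 a b" "rs_primitive f2 g \<Phi>2 a b"
  shows "rs_primitive (\<lambda>s. f1 s + f2 s) g (\<lambda>s. \<Phi>1 s + \<Phi>2 s) a b"
  unfolding rs_primitive_def
proof (intro allI impI)
  fix e :: real assume "0 < e"
  then have e2: "0 < e / 2" by simp
  obtain \<delta>1 where \<delta>1: "0 < \<delta>1" "\<And>c \<xi> d. a \<le> c \<Longrightarrow> c \<le> \<xi> \<Longrightarrow> \<xi> \<le> d \<Longrightarrow> d \<le> b \<Longrightarrow> d - c < \<delta>1 \<Longrightarrow>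
       norm (\<Phi>1 d - \<Phi>1 c - (g d - g c) *\<^sub>R f1 \<xi>) \<le> e / 2 * (d - c)"
    using rs_primitiveD[OF assms(1) e2] by metis
  obtain \<delta>2 where \<delta>2: "0 < \<delta>2" "\<And>c \<xi> d. a \<le> c \<Longrightarrow> c \<le> \<xi> \<Longrightarrow> \<xi> \<le> d \<Longrightarrow> d \<le> b \<Longrightarrow> d - c < \<delta>2 \<Longrightarrow>
       norm (\<Phi>2 d - \<Phi>2 c - (g d - g c) *\<^sub>R f2 \<xi>) \<le> e / 2 * (d - c)"
    using rs_primitiveD[OF assms(2) e2] by metis
  have "norm (\<Phi>1 d + \<Phi>2 d - (\<Phi>1 c + \<Phi>2 c) - (g d - g c) *\<^sub>R (f1 \<xi> + f2 \<xi>)) \<le> e * (d - c)"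
    if h: "a \<le> c" "c \<le> \<xi>" "\<xi> \<le> d" "d \<le> b" "d - c < min \<delta>1 \<delta>2" for c \<xi> d
  proof -
    have "\<Phi>1 d + \<Phi>2 d - (\<Phi>1 c + \<Phi>2 c) - (g d - g c) *\<^sub>R (f1 \<xi> + f2 \<xi>) =
      (\<Phi>1 d - \<Phi>1 c - (g d - g c) *\<^sub>R f1 \<xi>) + (\<Phi>2 d - \<Phi>2 c - (g d - g c) *\<^sub>R f2 \<xi>)"
      by (simp add: algebra_simps)
    also have "norm \<dots> \<le> e / 2 * (d - c) + e / 2 * (d - c)"
      using \<delta>1(2)[of c \<xi> d] \<delta>2(2)[of c \<xi> d] h by (intro norm_triangle_le add_mono) auto
    finally show ?thesis by simp
  qed
  with \<delta>1(1) \<delta>2(1) show "\<exists>\<delta>>0. \<forall>c \<xi> d. a \<le> c \<and> c \<le> \<xi> \<and> \<xi> \<le> d \<and> d \<le> b \<and> d - c < \<delta> \<longrightarrow>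
        norm (\<Phi>1 d + \<Phi>2 d - (\<Phi>1 c + \<Phi>2 c) - (g d - g c) *\<^sub>R (f1 \<xi> + f2 \<xi>)) \<le> e * (d - c)"
    by (intro exI[of _ "min \<delta>1 \<delta>2"]) auto
qed

lemma rs_primitive_sum:
  assumes "finite B" "\<And>i. i \<in> B \<Longrightarrow> rs_primitive (f i) g (\<Phi> i) a b"
  shows "rs_primitive (\<lambda>s. \<Sum>i\<in>B. f i s) g (\<lambda>s. \<Sum>i\<in>B. \<Phi> i s) a b"
  using assms by (induction B) (auto simp: rs_primitive_0 intro: rs_primitive_add)

text \<open>The expansion along \<open>B\<close> stands in for finite dimension: it reduces the
  claim to the real functions \<open>inner (f s) v\<close>, whose primitives are reassembled along
  the vectors \<open>v\<close>.\<close>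

lemma rs_primitive_exists:
  fixes f :: "real \<Rightarrow> 'a::real_inner"
  assumes "a \<le> b" "continuous_on {a..b} f" "L-lipschitz_on {a..b} g"
    and "finite B" and B: "\<And>s. s \<in> {a..b} \<Longrightarrow> f s = (\<Sum>v\<in>B. inner (f s) v *\<^sub>R v)"
  shows "\<exists>\<Phi>. rs_primitive f g \<Phi> a b"
proof -
  have "\<exists>\<Phi>. rs_primitive (\<lambda>s. inner (f s) v) g \<Phi> a b" for v
    using assms(1-3) by (intro rs_primitive_exists_real) (auto intro: continuous_intros)
  then obtain \<Phi> where "\<And>v. rs_primitive (\<lambda>s. inner (f s) v) g (\<Phi> v) a b" by metis
  then have "rs_primitive (\<lambda>s. \<Sum>v\<in>B. inner (f s) v *\<^sub>R v) g (\<lambda>s. \<Sum>v\<in>B. \<Phi> v s *\<^sub>R v) a b"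
    by (intro rs_primitive_sum rs_primitive_scaleR \<open>finite B\<close>)
  then have "rs_primitive f g (\<lambda>s. \<Sum>v\<in>B. \<Phi> v s *\<^sub>R v) a b"
    unfolding rs_primitive_def using B by (simp add: atLeastAtMost_iff)
  then show ?thesis by blast
qed

section \<open>Convergence of Euler polygons\<close>

text \<open>Induction on \<open>B\<close>: the scalar Arzela-Ascoli theorem extracts a further
  subsequence for each new vector, and the uniform limits already found survive passing to
  it.\<close>

lemma Arzela_Ascoli_finite_family:
  fixes f :: "nat \<Rightarrow> real \<Rightarrow> 'a::real_inner"
  assumes B: "finite B" and S: "compact S"
    and M: "\<And>n t. t \<in> S \<Longrightarrow> norm (f n t) \<le> M"
    and lip: "\<And>n. C-lipschitz_on S (f n)"
  shows "\<exists>r. strict_mono (r :: nat \<Rightarrow> nat) \<and>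
    (\<forall>v\<in>B. \<exists>g. uniform_limit S (\<lambda>n t. inner (f (r n) t) v) g sequentially)"
  using B
proof (induction B)
  case empty
  then show ?case by (auto intro: strict_mono_id[unfolded id_def])
next
  case (insert v B)
  then obtain r where r: "strict_mono (r :: nat \<Rightarrow> nat)"
    "\<And>w. w \<in> B \<Longrightarrow> \<exists>g. uniform_limit S (\<lambda>n t. inner (f (r n) t) w) g sequentially"
    by auto
  \<comment> \<open>The summand 1 makes \<open>D\<close> positive, so that \<open>e / D\<close> is a
    valid modulus even if \<open>C\<close> or \<open>v\<close> is 0.\<close>
  define D where "D = C * norm v + 1"
  have C: "0 \<le> C" using lip by (rule lipschitz_on_nonneg)
  have D: "0 < D" using C by (simp add: D_def add_nonneg_pos)
  obtain g k where k: "strict_mono (k :: nat \<Rightarrow> nat)"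
    "\<And>e. 0 < e \<Longrightarrow> \<exists>N. \<forall>n t. n \<ge> N \<and> t \<in> S \<longrightarrow> norm (inner (f (r (k n)) t) v - g t) < e"
  proof (rule Arzela_Ascoli[OF S, of "\<lambda>n t. inner (f (r n) t) v" "M * norm v"])
    show "norm (inner (f (r n) t) v) \<le> M * norm v" if "t \<in> S" for n t
      using Cauchy_Schwarz_ineq2[of "f (r n) t" v] mult_right_mono[OF M[OF that, of "r n"], of "norm v"]
      by simp
    show "\<exists>d>0. \<forall>n s. s \<in> S \<and> norm (t - s) < d \<longrightarrow>
        norm (inner (f (r n) t) v - inner (f (r n) s) v) < e" if "t \<in> S" "0 < e" for t e
    proof (intro exI[of _ "e / D"] conjI allI impI)
      show "0 < e / D" using that D by simp
      fix n s assume s: "s \<in> S \<and> norm (t - s) < e / D"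
      have "norm (inner (f (r n) t) v - inner (f (r n) s) v) \<le> norm (f (r n) t - f (r n) s) * norm v"
        using Cauchy_Schwarz_ineq2[of "f (r n) t - f (r n) s" v] by (simp add: inner_diff_left)
      also have "\<dots> \<le> (C * norm (t - s)) * norm v"
        using lipschitz_onD[OF lip[of "r n"], of t s] that s by (intro mult_right_mono) (auto simp: dist_norm)
      also have "\<dots> \<le> D * norm (t - s)"
        using mult_right_mono[of "C * norm v" D "norm (t - s)"] by (simp add: D_def mult_ac)
      also have "\<dots> < e" using s D by (simp add: field_simps)
      finally show "norm (inner (f (r n) t) v - inner (f (r n) s) v) < e" .
    qed
  qed auto
  have "uniform_limit S (\<lambda>n t. inner (f ((r \<circ> k) n) t) v) g sequentially"
    unfolding uniform_limit_sequentially_iff using k(2) by (simp add: dist_norm) blast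
  moreover have "\<exists>g. uniform_limit S (\<lambda>n t. inner (f ((r \<circ> k) n) t) w) g sequentially" if "w \<in> B" for w
  proof -
    obtain g where "uniform_limit S (\<lambda>n t. inner (f (r n) t) w) g sequentially" using r(2) \<open>w \<in> B\<close> by blast
    then have "uniform_limit S (\<lambda>n t. inner (f ((r \<circ> k) n) t) w) g sequentially"
      unfolding comp_def by (rule filterlim_compose) (rule filterlim_subseq[OF k(1)])
    then show ?thesis by blast
  qed
  ultimately show ?case using strict_mono_o[OF r(1) k(1)] by blast
qed

lemma Arzela_Ascoli_finite_dim:
  fixes f :: "nat \<Rightarrow> real \<Rightarrow> 'a::real_inner"
  assumes B: "finite B" and S: "compact S"
    and span: "\<And>n t. t \<in> S \<Longrightarrow> f n t = (\<Sum>v\<in>B. inner (f n t) v *\<^sub>R v)"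
    and M: "\<And>n t. t \<in> S \<Longrightarrow> norm (f n t) \<le> M"
    and lip: "\<And>n. C-lipschitz_on S (f n)"
  obtains g r where "strict_mono (r :: nat \<Rightarrow> nat)" "uniform_limit S (\<lambda>n. f (r n)) g sequentially"
proof -
  obtain r where r: "strict_mono (r :: nat \<Rightarrow> nat)"
    and "\<forall>v\<in>B. \<exists>g. uniform_limit S (\<lambda>n t. inner (f (r n) t) v) g sequentially"
    using Arzela_Ascoli_finite_family[where f=f, OF B S M lip] by auto
  then obtain g where
    g: "\<And>v. v \<in> B \<Longrightarrow> uniform_limit S (\<lambda>n t. inner (f (r n) t) v) (g v) sequentially"
    using bchoice by force
  have "uniform_limit S (\<lambda>n t. inner (f (r n) t) v *\<^sub>R v) (\<lambda>t. g v t *\<^sub>R v) sequentially" if "v \<in> B" for v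
    using bounded_linear.uniform_limit[OF bounded_linear_scaleR_left g[OF that], of v] .
  with B have "uniform_limit S (\<lambda>n t. \<Sum>v\<in>B. inner (f (r n) t) v *\<^sub>R v) (\<lambda>t. \<Sum>v\<in>B. g v t *\<^sub>R v) sequentially"
    by (induction B) (auto intro: uniform_limit_const uniform_limit_add)
  then have "uniform_limit S (\<lambda>n. f (r n)) (\<lambda>t. \<Sum>v\<in>B. g v t *\<^sub>R v) sequentially"
    by (rule uniform_limit_cong[THEN iffD1, rotated 2]) (auto simp flip: span)
  then show thesis using that r by blast
qed

text \<open>\<open>W\<close> is a Lyapunov function of the explicit Euler steps, so a discrete Gronwall argument keeps
  all polygons in one compact set. The finite set \<open>B\<close> spans the finite-dimensional space in which the
  values lie.\<close>

locale euler_scheme =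
  fixes T L c :: real and x :: "real \<Rightarrow> real ^ 'd" and G :: "'d \<Rightarrow> 'a::real_inner \<Rightarrow> 'a"
    and A B :: "'a set" and W :: "'a \<Rightarrow> real" and S0 :: 'a
  assumes T: "0 < T"
    and x: "L-lipschitz_on {0..T} x"
    and S0: "S0 \<in> A"
    and c: "0 \<le> c"
    and W_nonneg: "\<And>a. a \<in> A \<Longrightarrow> 0 \<le> W a"
    and W_compact: "\<And>r. compact {a \<in> A. W a \<le> r}"
    and B: "finite B"
    and span_A: "\<And>a. a \<in> A \<Longrightarrow> a = (\<Sum>v\<in>B. inner a v *\<^sub>R v)"
    and span_G: "\<And>j a. a \<in> A \<Longrightarrow> G j a = (\<Sum>v\<in>B. inner (G j a) v *\<^sub>R v)"
    and G_cont: "\<And>j. continuous_on A (G j)"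
    and step_A: "\<And>a v. a \<in> A \<Longrightarrow> a + (\<Sum>j\<in>UNIV. v $ j *\<^sub>R G j a) \<in> A"
    and step_W: "\<And>a v. a \<in> A \<Longrightarrow> norm v \<le> L * T \<Longrightarrow>
      W (a + (\<Sum>j\<in>UNIV. v $ j *\<^sub>R G j a)) \<le> (1 + c * norm v) * W a"
begin

definition incr :: "real ^ 'd \<Rightarrow> 'a \<Rightarrow> 'a" where
  "incr v a = (\<Sum>j\<in>UNIV. v $ j *\<^sub>R G j a)"

text \<open>There are \<open>Suc n\<close> cells, so the mesh \<open>T / real (Suc n)\<close> makes
  sense for every \<open>n\<close>, including 0.\<close>

definition grid :: "nat \<Rightarrow> nat \<Rightarrow> real" where
  "grid n k = real k * T / real (Suc n)"

primrec node :: "nat \<Rightarrow> nat \<Rightarrow> 'a" where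
  "node n 0 = S0"
| "node n (Suc k) = node n k + incr (x (grid n (Suc k)) - x (grid n k)) (node n k)"

definition clamp :: "nat \<Rightarrow> nat \<Rightarrow> real \<Rightarrow> real" where
  "clamp n k t = max (grid n k) (min (grid n (Suc k)) t)"

text \<open>Within a cell the path follows \<open>x\<close> itself instead of a chord. The sum runs
  over all cells with the time clamped to each: past cells contribute their full step, future ones
  0. In this form increments in time and comparison with Riemann-Stieltjes sums need no case
  distinction on the current cell.\<close>

definition polygon :: "nat \<Rightarrow> real \<Rightarrow> 'a" where
  "polygon n t = S0 + (\<Sum>k<Suc n. incr (x (clamp n k t) - x (grid n k)) (node n k))"

text \<open>\<open>exp (c * L * T)\<close> dominates the growth factor accumulated over
  \<open>[0, T]\<close> for every mesh.\<close>

definition bound :: real where "bound = exp (c * L * T) * W S0"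

lemma L_nonneg: "0 \<le> L"
  using x by (rule lipschitz_on_nonneg)

lemma x_lip: "s \<in> {0..T} \<Longrightarrow> t \<in> {0..T} \<Longrightarrow> norm (x s - x t) \<le> L * \<bar>s - t\<bar>"
  using lipschitz_onD[OF x] by (simp add: dist_norm)

lemma incr_0 [simp]: "incr 0 a = 0"
  by (simp add: incr_def)

lemma incr_diff: "incr u a - incr v a = incr (u - v) a"
  by (simp add: incr_def scaleR_left_diff_distrib sum_subtractf)

section \<open>Grid and clamped times\<close>

lemma grid_simps [simp]: "grid n 0 = 0" "grid n (Suc n) = T"
  by (auto simp: grid_def)

lemma grid_mono: "i \<le> k \<Longrightarrow> grid n i \<le> grid n k"
  using T by (auto simp: grid_def divide_right_mono mult_right_mono)

lemma grid_Suc: "grid n (Suc k) = grid n k + T / real (Suc n)"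
  unfolding grid_def of_nat_Suc distrib_right add_divide_distrib by simp

lemma grid_in: "k \<le> Suc n \<Longrightarrow> grid n k \<in> {0..T}"
  using grid_mono[of 0 k n] grid_mono[of k "Suc n" n] by simp

lemma grid_cell:
  assumes "t \<in> {0..T}"
  obtains k where "k \<le> n" "grid n k \<le> t" "t \<le> grid n (Suc k)"
proof -
  have "\<exists>k<m. grid n k \<le> t \<and> t \<le> grid n (Suc k)" if "t \<le> grid n m" "0 < m" for m
    using that
  proof (induction m)
    case (Suc m)
    show ?case
    proof (cases "0 < m \<and> t \<le> grid n m")
      case True
      then show ?thesis using Suc.IH less_SucI by blast
    next
      case False
      then have "grid n m \<le> t" using assms by auto
      then show ?thesis using Suc.prems by blast
    qed
  qed simp
  from this[of "Suc n"] assms that show thesis by (auto simp: less_Suc_eq_le)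
qed

text \<open>Differences of minima telescope over \<open>k\<close>, differences of clamped times do
  not visibly do so; hence this rewriting.\<close>

lemma clamp_eq_min: "clamp n k t = grid n k + (min (grid n (Suc k)) t - min (grid n k) t)"
  using grid_mono[of k "Suc k" n] by (auto simp: clamp_def)

lemma x_clamp_diff:
  "x (clamp n k t) - x (grid n k) = x (min (grid n (Suc k)) t) - x (min (grid n k) t)"
  using grid_mono[of k "Suc k" n] by (auto simp: clamp_def min_def max_def)

lemma clamp_in: "k \<le> n \<Longrightarrow> clamp n k t \<in> {0..T}"
  using grid_in[of k n] grid_in[of "Suc k" n] grid_mono[of k "Suc k" n] by (auto simp: clamp_def)

lemma clamp_mono: "s \<le> t \<Longrightarrow> clamp n k s \<le> clamp n k t"
  by (auto simp: clamp_def)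

lemma sum_clamp:
  assumes "s \<in> {0..T}" "t \<in> {0..T}"
  shows "(\<Sum>k<Suc n. clamp n k t - clamp n k s) = t - s"
proof -
  have *: "(\<Sum>k<Suc n. min (grid n (Suc k)) r - min (grid n k) r) = r" if "r \<in> {0..T}" for r
    using that by (subst sum_lessThan_telescope) auto
  have "(\<Sum>k<Suc n. clamp n k t - clamp n k s)
     = (\<Sum>k<Suc n. min (grid n (Suc k)) t - min (grid n k) t)
       - (\<Sum>k<Suc n. min (grid n (Suc k)) s - min (grid n k) s)"
    unfolding sum_subtractf[symmetric] by (intro sum.cong) (auto simp: clamp_eq_min)
  then show ?thesis by (simp only: *[OF assms(1)] *[OF assms(2)])
qed

section \<open>Nodes, polygons and the discrete Gronwall estimate\<close>

lemma incr_in: "a \<in> A \<Longrightarrow> a + incr v a \<in> A"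
  unfolding incr_def by (rule step_A)

text \<open>No restriction on \<open>k\<close> is needed, even where the grid runs past
  \<open>T\<close>, because \<open>step_A\<close> allows increments of any size.\<close>

lemma node_in: "node n k \<in> A"
  by (induction k) (auto simp: S0 incr_in)

lemma node_eq_sum: "node n k = S0 + (\<Sum>i<k. incr (x (grid n (Suc i)) - x (grid n i)) (node n i))"
  by (induction k) auto

lemma polygon_cell:
  assumes k: "k \<le> n" and t: "grid n k \<le> t" "t \<le> grid n (Suc k)"
  shows "polygon n t = node n k + incr (x t - x (grid n k)) (node n k)"
proof -
  let ?g = "\<lambda>i. incr (x (clamp n i t) - x (grid n i)) (node n i)"
  have below: "?g i = incr (x (grid n (Suc i)) - x (grid n i)) (node n i)" if "i < k" for i
  proof -
    have "grid n (Suc i) \<le> t" using grid_mono[of "Suc i" k n] that t by simp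
    then show ?thesis using grid_mono[of i "Suc i" n] by (simp add: clamp_def)
  qed
  have above: "?g i = 0" if "k < i" for i
  proof -
    have "t \<le> grid n i" using grid_mono[of "Suc k" i n] that t by simp
    then show ?thesis using grid_mono[of i "Suc i" n] by (simp add: clamp_def)
  qed
  have "(\<Sum>i<Suc n. ?g i) = (\<Sum>i<Suc k. ?g i)"
    using k above by (intro sum.mono_neutral_right) auto
  also have "\<dots> = (\<Sum>i<k. incr (x (grid n (Suc i)) - x (grid n i)) (node n i))
      + incr (x t - x (grid n k)) (node n k)"
    using below t by (simp add: clamp_def)
  finally show ?thesis
    by (simp only: polygon_def node_eq_sum[of n k] add.assoc)
qed

lemma polygon_grid: "k \<le> n \<Longrightarrow> polygon n (grid n k) = node n k"
  using grid_mono[of k "Suc k" n] by (simp add: polygon_cell)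

text \<open>The times \<open>s\<close> and \<open>t\<close> are arbitrary up to a distance of one
  mesh, so that the estimate serves both for full steps between nodes and for the partial step
  inside a cell.\<close>

lemma step_bound:
  assumes "a \<in> A" "W a \<le> (1 + c * L * T / real (Suc n)) ^ k * W S0"
    and st: "s \<in> {0..T}" "t \<in> {0..T}" "s \<le> t" "t \<le> s + T / real (Suc n)"
  shows "W (a + incr (x t - x s) a) \<le> (1 + c * L * T / real (Suc n)) ^ Suc k * W S0"
proof -
  have "norm (x t - x s) \<le> L * (t - s)" using x_lip[OF st(2,1)] st(3) by simp
  also have "\<dots> \<le> L * (T / real (Suc n))" using st(4) L_nonneg by (intro mult_left_mono) auto
  finally have v: "norm (x t - x s) \<le> L * (T / real (Suc n))" .
  \<comment> \<open>\<open>step_W\<close> is available only for increments of norm at most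
    \<open>L * T\<close>.\<close>
  also have "\<dots> \<le> L * (T / 1)" using T L_nonneg by (intro mult_left_mono divide_left_mono) auto
  finally have "W (a + incr (x t - x s) a) \<le> (1 + c * norm (x t - x s)) * W a"
    unfolding incr_def using assms(1) by (intro step_W) auto
  also have "\<dots> \<le> (1 + c * L * T / real (Suc n)) * W a"
    using mult_left_mono[OF v c] W_nonneg[OF assms(1)] by (intro mult_right_mono) (auto simp: mult.assoc)
  also have "\<dots> \<le> (1 + c * L * T / real (Suc n)) * ((1 + c * L * T / real (Suc n)) ^ k * W S0)"
    using assms(2) c L_nonneg T by (intro mult_left_mono) (auto simp: add_nonneg_nonneg)
  finally show ?thesis by (simp add: mult_ac)
qed

lemma node_bound: "k \<le> Suc n \<Longrightarrow> W (node n k) \<le> (1 + c * L * T / real (Suc n)) ^ k * W S0"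
proof (induction k)
  case (Suc k)
  then show ?case
    using step_bound[of "node n k" n k "grid n k" "grid n (Suc k)"] node_in grid_in[of k n]
      grid_in[of "Suc k" n] grid_mono[of k "Suc k" n] grid_Suc[of n k] by simp
qed simp

lemma growth_le_bound:
  assumes "k \<le> Suc n"
  shows "(1 + c * L * T / real (Suc n)) ^ k * W S0 \<le> bound"
proof -
  have nonneg: "0 \<le> c * L * T / real (Suc n)" using c L_nonneg T by simp
  have "(1 + c * L * T / real (Suc n)) ^ k \<le> (1 + c * L * T / real (Suc n)) ^ Suc n"
    using assms nonneg by (intro power_increasing) auto
  also have "\<dots> \<le> exp (c * L * T / real (Suc n)) ^ Suc n"
    using nonneg by (intro power_mono exp_ge_add_one_self) auto
  also have "\<dots> = exp (c * L * T)"
    by (subst exp_of_nat_mult[symmetric]) (simp del: of_nat_Suc)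
  finally show ?thesis unfolding bound_def using W_nonneg[OF S0] by (rule mult_right_mono)
qed

section \<open>A compact set and a Lipschitz constant common to all polygons\<close>

definition K :: "'a set" where "K = {a \<in> A. W a \<le> bound}"

lemma compact_K: "compact K"
  unfolding K_def by (rule W_compact)

lemma G_cont_K: "continuous_on K (G j)"
  by (rule continuous_on_subset[OF G_cont]) (auto simp: K_def)

lemma polygon_in_K:
  assumes t: "t \<in> {0..T}"
  shows "polygon n t \<in> K"
proof -
  obtain k where k: "k \<le> n" "grid n k \<le> t" "t \<le> grid n (Suc k)"
    using grid_cell[OF t] by metis
  have "W (polygon n t) \<le> (1 + c * L * T / real (Suc n)) ^ Suc k * W S0"
    unfolding polygon_cell[OF k]
    using k t grid_in[of k n] grid_Suc[of n k] by (intro step_bound node_in node_bound) auto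
  also have "\<dots> \<le> bound" using k by (intro growth_le_bound) auto
  finally show ?thesis
    using polygon_cell[OF k] incr_in[OF node_in] by (simp add: K_def)
qed

lemma node_in_K: "k \<le> n \<Longrightarrow> node n k \<in> K"
  using polygon_in_K[OF grid_in] polygon_grid by (metis le_SucI)

lemma G_bounded: obtains M where "0 \<le> M" "\<And>j a. a \<in> K \<Longrightarrow> norm (G j a) \<le> M"
proof -
  have "\<exists>M. \<forall>a\<in>K. norm (G j a) \<le> M" for j
  proof -
    have "compact (G j ` K)"
      using G_cont_K compact_K by (rule compact_continuous_image)
    then have "bounded (G j ` K)" by (rule compact_imp_bounded)
    then show ?thesis by (auto simp: bounded_iff)
  qed
  then obtain M where M: "\<And>j a. a \<in> K \<Longrightarrow> norm (G j a) \<le> M j" by metis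
  have "norm (G j a) \<le> (\<Sum>j\<in>UNIV. \<bar>M j\<bar>)" if "a \<in> K" for j a
  proof -
    have "norm (G j a) \<le> \<bar>M j\<bar>" using M[OF that, of j] by simp
    also have "\<dots> \<le> (\<Sum>j\<in>UNIV. \<bar>M j\<bar>)" by (rule member_le_sum) auto
    finally show ?thesis .
  qed
  then show thesis using that[of "\<Sum>j\<in>UNIV. \<bar>M j\<bar>"] by (simp add: sum_nonneg)
qed

text \<open>Between \<open>s\<close> and \<open>t\<close> every cell contributes an increment of
  \<open>x\<close> over the part of \<open>[s, t]\<close> inside that cell, applied to a node in
  \<open>K\<close>; by \<open>sum_clamp\<close> these parts have total length
  \<open>t - s\<close>.\<close>

lemma polygon_lipschitz: obtains C where "\<And>n. C-lipschitz_on {0..T} (polygon n)"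
proof -
  obtain M where M: "0 \<le> M" "\<And>j a. a \<in> K \<Longrightarrow> norm (G j a) \<le> M" using G_bounded by metis
  define C where "C = L * (real CARD('d) * M)"
  have incr_le: "norm (incr v a) \<le> norm v * (real CARD('d) * M)" if "a \<in> K" for v a
  proof -
    have "norm (incr v a) \<le> (\<Sum>j\<in>(UNIV :: 'd set). norm v * M)"
      unfolding incr_def using M that component_le_norm_cart[of v]
      by (intro sum_norm_le) (auto intro: mult_mono)
    then show ?thesis by (simp add: mult_ac)
  qed
  have le: "dist (polygon n t) (polygon n s) \<le> C * dist t s"
    if st: "s \<in> {0..T}" "t \<in> {0..T}" "s \<le> t" for n s t
  proof -
    have "dist (polygon n t) (polygon n s)
        = norm (\<Sum>k<Suc n. incr (x (clamp n k t) - x (clamp n k s)) (node n k))"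
      unfolding polygon_def dist_norm
      by (simp add: incr_diff flip: sum_subtractf del: sum.lessThan_Suc)
    also have "\<dots> \<le> (\<Sum>k<Suc n. C * (clamp n k t - clamp n k s))"
    proof (rule sum_norm_le)
      fix k assume "k \<in> {..<Suc n}"
      then have k: "k \<le> n" by simp
      have "norm (incr (x (clamp n k t) - x (clamp n k s)) (node n k))
          \<le> norm (x (clamp n k t) - x (clamp n k s)) * (real CARD('d) * M)"
        by (rule incr_le[OF node_in_K[OF k]])
      also have "\<dots> \<le> (L * (clamp n k t - clamp n k s)) * (real CARD('d) * M)"
        using x_lip[OF clamp_in[OF k] clamp_in[OF k], of t s] clamp_mono[OF st(3), of n k] M(1)
        by (intro mult_right_mono) auto
      finally show "norm (incr (x (clamp n k t) - x (clamp n k s)) (node n k)) \<le> C * (clamp n k t - clamp n k s)"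
        by (simp add: C_def mult_ac)
    qed
    also have "\<dots> = C * (t - s)"
      using sum_clamp[OF st(1,2), of n] by (simp only: flip: sum_distrib_left)
    finally show ?thesis using st(3) by (simp add: dist_real_def)
  qed
  have "C-lipschitz_on {0..T} (polygon n)" for n
  proof (rule lipschitz_onI)
    show "0 \<le> C" using M(1) L_nonneg by (simp add: C_def)
    show "dist (polygon n s) (polygon n t) \<le> C * dist s t" if "s \<in> {0..T}" "t \<in> {0..T}" for s t
      using le[of s t n] le[of t s n] that by (cases "s \<le> t") (auto simp: dist_commute)
  qed
  then show thesis using that by blast
qed

section \<open>Polygons as Riemann-Stieltjes sums and the passage to the limit\<close>

lemma polygon_eq_sum:
  "polygon n t = S0 + (\<Sum>j\<in>UNIV. \<Sum>k<Suc n.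
     (x (min (grid n (Suc k)) t) $ j - x (min (grid n k) t) $ j) *\<^sub>R G j (node n k))"
  unfolding polygon_def x_clamp_diff incr_def by (subst sum.swap) simp

text \<open>Each cell has two errors. Evaluating \<open>G j\<close> at the node instead of at
  \<open>S\<close> costs \<open>e\<close> times the increment of \<open>x\<close>, by uniform
  continuity on \<open>K\<close>; replacing the left-tagged term for \<open>S\<close> by the
  increment of \<open>\<Phi>\<close> costs \<open>e\<close> times the cell length. Together they sum
  to at most \<open>e * (L * T + T)\<close>.\<close>

lemma polygon_near_primitive:
  assumes S: "\<And>s. s \<in> {0..T} \<Longrightarrow> S s \<in> K"
    and prim: "rs_primitive (\<lambda>s. G j (S s)) (\<lambda>s. x s $ j) \<Phi> 0 T"
    and t: "t \<in> {0..T}" and e: "0 < e"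
  obtains \<delta> where "0 < \<delta>"
    "\<And>n. T / real (Suc n) < \<delta> \<Longrightarrow> (\<forall>s\<in>{0..T}. dist (polygon n s) (S s) < \<delta>) \<Longrightarrow>
      norm ((\<Sum>k<Suc n. (x (min (grid n (Suc k)) t) $ j - x (min (grid n k) t) $ j) *\<^sub>R G j (node n k))
        - (\<Phi> t - \<Phi> 0)) \<le> e * ((1 + L) * T)"
proof -
  obtain \<delta>1 where \<delta>1: "0 < \<delta>1"
    "\<And>c \<xi> d. 0 \<le> c \<Longrightarrow> c \<le> \<xi> \<Longrightarrow> \<xi> \<le> d \<Longrightarrow> d \<le> T \<Longrightarrow> d - c < \<delta>1 \<Longrightarrow>
       norm (\<Phi> d - \<Phi> c - (x d $ j - x c $ j) *\<^sub>R G j (S \<xi>)) \<le> e * (d - c)"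
    using rs_primitiveD[OF prim e] by metis
  have "uniformly_continuous_on K (G j)"
    using G_cont_K compact_K by (rule compact_uniformly_continuous)
  then obtain \<delta>2 where \<delta>2: "0 < \<delta>2"
    "\<And>a b. a \<in> K \<Longrightarrow> b \<in> K \<Longrightarrow> dist a b < \<delta>2 \<Longrightarrow> dist (G j a) (G j b) < e"
    using e unfolding uniformly_continuous_on_def by metis
  show thesis
  proof (rule that[of "min \<delta>1 \<delta>2"])
    show "0 < min \<delta>1 \<delta>2" using \<delta>1(1) \<delta>2(1) by simp
    fix n assume n: "T / real (Suc n) < min \<delta>1 \<delta>2" "\<forall>s\<in>{0..T}. dist (polygon n s) (S s) < min \<delta>1 \<delta>2"
    \<comment> \<open>The grid stopped at \<open>t\<close>: it partitions \<open>[0, t]\<close>, and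
      all cells beyond \<open>t\<close> are degenerate.\<close>
    define \<tau> where "\<tau> = (\<lambda>k. min (grid n k) t)"
    have \<tau>_le: "\<tau> k \<le> \<tau> (Suc k)" for k using grid_mono[of k "Suc k" n] by (auto simp: \<tau>_def)
    have \<tau>_in: "\<tau> k \<in> {0..T}" for k using t grid_mono[of 0 k n] by (auto simp: \<tau>_def)
    have \<tau>_diff: "\<tau> (Suc k) - \<tau> k < \<delta>1" for k
    proof -
      have "\<tau> (Suc k) - \<tau> k \<le> T / real (Suc n)"
        using grid_Suc[of n k] grid_mono[of k "Suc k" n] by (auto simp: \<tau>_def min_def)
      then show ?thesis using n(1) by linarith
    qed
    have \<tau>_ends: "\<tau> 0 = 0" "\<tau> (Suc n) = t" using t by (auto simp: \<tau>_def)
    have term_le: "norm ((x (\<tau> (Suc k)) $ j - x (\<tau> k) $ j) *\<^sub>R G j (node n k) - (\<Phi> (\<tau> (Suc k)) - \<Phi> (\<tau> k)))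
        \<le> e * (1 + L) * (\<tau> (Suc k) - \<tau> k)" if k: "k < Suc n" for k
    proof -
      let ?dx = "x (\<tau> (Suc k)) $ j - x (\<tau> k) $ j"
      have "\<bar>?dx\<bar> \<le> norm (x (\<tau> (Suc k)) - x (\<tau> k))"
        using component_le_norm_cart[of "x (\<tau> (Suc k)) - x (\<tau> k)" j] by simp
      also have "\<dots> \<le> L * (\<tau> (Suc k) - \<tau> k)"
        using x_lip[OF \<tau>_in \<tau>_in, of "Suc k" k] \<tau>_le[of k] by simp
      finally have dx: "\<bar>?dx\<bar> \<le> L * (\<tau> (Suc k) - \<tau> k)" .
      have "norm (?dx *\<^sub>R (G j (node n k) - G j (S (\<tau> k)))) \<le> L * (\<tau> (Suc k) - \<tau> k) * e"
      \<comment> \<open>A node can be compared with \<open>S (\<tau> k)\<close> only if its grid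
        time has not passed \<open>t\<close>; otherwise the cell is degenerate and the term is
        0.\<close>
      proof (cases "grid n k \<le> t")
        case True
        then have eq: "\<tau> k = grid n k" by (simp add: \<tau>_def)
        have "dist (G j (node n k)) (G j (S (\<tau> k))) < e"
          using n(2) \<tau>_in[of k] k node_in_K[of k n] S
          by (intro \<delta>2(2)) (auto simp: eq simp flip: polygon_grid)
        then show ?thesis
          using dx L_nonneg \<tau>_le[of k] by (simp add: dist_norm mult_mono)
      next
        case False
        then have "\<tau> (Suc k) = \<tau> k" using grid_mono[of k "Suc k" n] by (simp add: \<tau>_def)
        then show ?thesis by simp
      qed
      moreover have "norm (\<Phi> (\<tau> (Suc k)) - \<Phi> (\<tau> k) - ?dx *\<^sub>R G j (S (\<tau> k))) \<le> e * (\<tau> (Suc k) - \<tau> k)"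
        using \<tau>_in[of k] \<tau>_in[of "Suc k"] \<tau>_le[of k] \<tau>_diff[of k] by (intro \<delta>1(2)) auto
      moreover have "?dx *\<^sub>R G j (node n k) - (\<Phi> (\<tau> (Suc k)) - \<Phi> (\<tau> k))
          = ?dx *\<^sub>R (G j (node n k) - G j (S (\<tau> k)))
            - (\<Phi> (\<tau> (Suc k)) - \<Phi> (\<tau> k) - ?dx *\<^sub>R G j (S (\<tau> k)))"
        by (simp add: scaleR_right_diff_distrib)
      ultimately have "norm (?dx *\<^sub>R G j (node n k) - (\<Phi> (\<tau> (Suc k)) - \<Phi> (\<tau> k)))
          \<le> L * (\<tau> (Suc k) - \<tau> k) * e + e * (\<tau> (Suc k) - \<tau> k)"
        by (simp only: order_trans[OF norm_triangle_ineq4 add_mono])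
      then show ?thesis by (simp add: algebra_simps)
    qed
    have tele: "(\<Sum>k<Suc n. \<psi> (\<tau> (Suc k)) - \<psi> (\<tau> k)) = \<psi> t - \<psi> 0" for \<psi> :: "real \<Rightarrow> 'e::real_normed_vector"
      by (subst sum_lessThan_telescope) (simp only: \<tau>_ends)
    have "(\<Sum>k<Suc n. (x (\<tau> (Suc k)) $ j - x (\<tau> k) $ j) *\<^sub>R G j (node n k)) - (\<Phi> t - \<Phi> 0)
      = (\<Sum>k<Suc n. (x (\<tau> (Suc k)) $ j - x (\<tau> k) $ j) *\<^sub>R G j (node n k) - (\<Phi> (\<tau> (Suc k)) - \<Phi> (\<tau> k)))"
      unfolding tele[of \<Phi>, symmetric] by (rule sum_subtractf[symmetric])
    also have "norm \<dots> \<le> (\<Sum>k<Suc n. e * (1 + L) * (\<tau> (Suc k) - \<tau> k))"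
      using term_le by (intro sum_norm_le) auto
    also have "\<dots> = e * (1 + L) * t"
      using tele[of "\<lambda>s. s"] by (simp only: diff_zero flip: sum_distrib_left)
    also have "\<dots> \<le> e * ((1 + L) * T)"
      using e L_nonneg t by (simp add: mult_left_mono)
    finally show "norm ((\<Sum>k<Suc n. (x (min (grid n (Suc k)) t) $ j - x (min (grid n k) t) $ j) *\<^sub>R G j (node n k))
        - (\<Phi> t - \<Phi> 0)) \<le> e * ((1 + L) * T)"
      by (simp only: \<tau>_def)
  qed
qed

theorem exists_solution:
  "\<exists>S. continuous_on {0..T} S \<and> (\<forall>t\<in>{0..T}. S t \<in> A) \<and>
     (\<forall>t\<in>{0..T}. \<exists>I. (\<forall>j. has_rs_integral (\<lambda>s. G j (S s)) (\<lambda>s. x s $ j) (I j) 0 t) \<and>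
        S t = S0 + (\<Sum>j\<in>UNIV. I j))"
proof -
  obtain C where C: "\<And>n. C-lipschitz_on {0..T} (polygon n)" using polygon_lipschitz by metis
  obtain M where M: "\<And>a. a \<in> K \<Longrightarrow> norm a \<le> M"
    using compact_imp_bounded[OF compact_K] unfolding bounded_iff by metis
  obtain S r where r: "strict_mono (r :: nat \<Rightarrow> nat)"
    and lim: "uniform_limit {0..T} (\<lambda>n. polygon (r n)) S sequentially"
  proof (rule Arzela_Ascoli_finite_dim[OF B compact_Icc, of 0 T polygon M C])
    show "polygon n t = (\<Sum>v\<in>B. inner (polygon n t) v *\<^sub>R v)" if "t \<in> {0..T}" for n t
      using polygon_in_K[OF that, of n] by (intro span_A) (simp add: K_def)
  qed (use M polygon_in_K C in auto)
  have S_cont: "continuous_on {0..T} S"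
    by (rule uniform_limit_theorem[OF _ lim])
       (auto intro!: always_eventually lipschitz_on_continuous_on C)
  have S_lim: "(\<lambda>n. polygon (r n) t) \<longlonglongrightarrow> S t" if "t \<in> {0..T}" for t
    using tendsto_uniform_limitI[OF lim that] .
  have S_in: "S t \<in> K" if "t \<in> {0..T}" for t
    using closed_sequentially[OF compact_imp_closed[OF compact_K] _ S_lim[OF that]] polygon_in_K[OF that] by blast
  have "\<exists>\<Phi>. rs_primitive (\<lambda>s. G j (S s)) (\<lambda>s. x s $ j) \<Phi> 0 T" for j
  proof (rule rs_primitive_exists[OF _ _ _ B])
    show "continuous_on {0..T} (\<lambda>s. G j (S s))"
      using S_in by (intro continuous_on_compose2[OF G_cont S_cont]) (auto simp: K_def)
    show "L-lipschitz_on {0..T} (\<lambda>s. x s $ j)"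
    proof (rule lipschitz_onI)
      show "dist (x s $ j) (x t $ j) \<le> L * dist s t" if "s \<in> {0..T}" "t \<in> {0..T}" for s t
        using order_trans[OF dist_vec_nth_le lipschitz_onD[OF x that]] .
    qed (rule L_nonneg)
    show "G j (S s) = (\<Sum>v\<in>B. inner (G j (S s)) v *\<^sub>R v)" if "s \<in> {0..T}" for s
      using S_in[OF that] by (intro span_G) (simp add: K_def)
  qed (use T in simp)
  then obtain \<Phi> where \<Phi>: "\<And>j. rs_primitive (\<lambda>s. G j (S s)) (\<lambda>s. x s $ j) (\<Phi> j) 0 T" by metis
  have eq: "S t = S0 + (\<Sum>j\<in>UNIV. \<Phi> j t - \<Phi> j 0)" if t: "t \<in> {0..T}" for t
  proof -
    define R where "R n j = (\<Sum>k<Suc n.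
      (x (min (grid n (Suc k)) t) $ j - x (min (grid n k) t) $ j) *\<^sub>R G j (node n k))" for n j
    have "(\<lambda>n. R (r n) j) \<longlonglongrightarrow> \<Phi> j t - \<Phi> j 0" for j
    proof (rule tendstoI)
      fix e :: real assume "0 < e"
      define e' where "e' = e / ((1 + L) * T + 1)"
      have "0 \<le> (1 + L) * T" using T L_nonneg by simp
      then have e': "0 < e'" "e' * ((1 + L) * T) < e"
        using \<open>0 < e\<close> by (auto simp: e'_def divide_less_eq intro: mult_strict_left_mono)
      obtain \<delta> where \<delta>: "0 < \<delta>"
        "\<And>n. T / real (Suc n) < \<delta> \<Longrightarrow> (\<forall>s\<in>{0..T}. dist (polygon n s) (S s) < \<delta>) \<Longrightarrow>
          norm (R n j - (\<Phi> j t - \<Phi> j 0)) \<le> e' * ((1 + L) * T)"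
        by (rule polygon_near_primitive[OF S_in \<Phi>[of j] t e'(1), folded R_def], assumption) (rule that)
      have "(\<lambda>n. T / real (Suc n)) \<longlonglongrightarrow> 0"
        by (intro LIMSEQ_Suc[OF lim_const_over_n])
      then have "(\<lambda>n. T / real (Suc (r n))) \<longlonglongrightarrow> 0"
        using LIMSEQ_subseq_LIMSEQ[OF _ r] by (auto simp: comp_def)
      then have "\<forall>\<^sub>F n in sequentially. T / real (Suc (r n)) < \<delta>"
        using \<delta>(1) by (rule order_tendstoD(2))
      moreover have "\<forall>\<^sub>F n in sequentially. \<forall>s\<in>{0..T}. dist (polygon (r n) s) (S s) < \<delta>"
        using uniform_limitD[OF lim \<delta>(1)] .
      ultimately show "\<forall>\<^sub>F n in sequentially. dist (R (r n) j) (\<Phi> j t - \<Phi> j 0) < e"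
      proof eventually_elim
        case (elim n)
        then show ?case using \<delta>(2)[of "r n"] e'(2) by (simp add: dist_norm)
      qed
    qed
    then have "(\<lambda>n. S0 + (\<Sum>j\<in>UNIV. R (r n) j)) \<longlonglongrightarrow> S0 + (\<Sum>j\<in>UNIV. \<Phi> j t - \<Phi> j 0)"
      by (intro tendsto_intros)
    \<comment> \<open>The values of the polygons at \<open>t\<close> converge to \<open>S t\<close>
      by uniform convergence and, being these very sums, also to the right-hand side.\<close>
    then show ?thesis
      using LIMSEQ_unique[OF S_lim[OF t]] unfolding polygon_eq_sum R_def by blast
  qed
  have "\<exists>I. (\<forall>j. has_rs_integral (\<lambda>s. G j (S s)) (\<lambda>s. x s $ j) (I j) 0 t) \<and> S t = S0 + (\<Sum>j\<in>UNIV. I j)"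
    if t: "t \<in> {0..T}" for t
    using t eq[OF t] rs_primitive_imp_has_rs_integral[OF \<Phi>]
    by (intro exI[of _ "\<lambda>j. \<Phi> j t - \<Phi> j 0"]) auto
  with S_cont S_in show ?thesis unfolding K_def by (intro exI[of _ S]) auto
qed

end

section \<open>Homogeneous norms on truncated tensors\<close>

lemma tcoeff_sum [simp]: "tcoeff (sum f A) w = (\<Sum>i\<in>A. tcoeff (f i) w)"
  by (induction A rule: infinite_finite_induct) auto

lemma tcoeff_level [simp]: "tcoeff (level n a) w = (if length w = n then tcoeff a w else 0)"
  by transfer simp

lemma tcoeff_tone [simp]: "tcoeff tone w = (if w = [] then 1 else 0)"
  by transfer simp

lemma tcoeff_dilation [simp]: "tcoeff (dilation c a) w = c ^ length w * tcoeff a w"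
  by transfer simp

lemma tcoeff_tmult: "tcoeff (tmult N a b) w =
    (if length w \<le> N then \<Sum>k\<le>length w. tcoeff a (take k w) * tcoeff b (drop k w) else 0)"
  by transfer simp

lemma tcoeff_trunc [simp]: "tcoeff (trunc n a) w = (if length w \<le> n then tcoeff a w else 0)"
  by (simp add: trunc_def)

lift_definition basis_tensor :: "'m list \<Rightarrow> 'm tensor" is "\<lambda>u w. if w = u then 1 else 0"
  by (rule finite_subset[of _ "{_}"]) auto

lemma tcoeff_basis_tensor [simp]: "tcoeff (basis_tensor u) w = (if w = u then 1 else 0)"
  by transfer simp

text \<open>Reading coordinates as inner products yields their continuity, their bound by the norm,
  and the expansion that the Euler scheme asks for.\<close>

lemma inner_basis_tensor: "inner a (basis_tensor w) = tcoeff a w"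
proof -
  have "inner (basis_tensor w) a = tcoeff a w"
    unfolding inner_tensor_def
    by (subst tensor_inner_superset[of "{w}"]) auto
  then show ?thesis by (simp add: inner_commute)
qed

lemma norm_basis_tensor [simp]: "norm (basis_tensor w) = 1"
  by (simp add: norm_eq_sqrt_inner inner_basis_tensor)

lemma abs_tcoeff_le_norm: "\<bar>tcoeff a w\<bar> \<le> norm a"
  using Cauchy_Schwarz_ineq2[of a "basis_tensor w"] by (simp add: inner_basis_tensor)

definition words :: "nat \<Rightarrow> 'm list set" where
  "words N = {w. length w \<le> N}"

lemma finite_words [simp]: "finite (words N :: 'm::finite list set)"
  using finite_lists_length_le[of "UNIV :: 'm set" N] by (simp add: words_def)

lemma trunc_tensors_iff: "a \<in> trunc_tensors N \<longleftrightarrow> (\<forall>w. N < length w \<longrightarrow> tcoeff a w = 0)"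
  by (auto simp: trunc_tensors_def intro!: tensor_eqI dest: arg_cong[where f="\<lambda>t. tcoeff t _"])
     (metis tcoeff_level tcoeff_simps(1))

lemma trunc_tensors_expansion:
  fixes a :: "'m::finite tensor"
  assumes "a \<in> trunc_tensors N"
  shows "a = (\<Sum>w\<in>words N. tcoeff a w *\<^sub>R basis_tensor w)"
proof (rule tensor_eqI)
  fix u
  have "(\<Sum>w\<in>words N. tcoeff a w * (if u = w then 1 else 0)) = (if u \<in> words N then tcoeff a u else 0)"
    by (simp add: if_distrib cong: if_cong)
  then show "tcoeff a u = tcoeff (\<Sum>w\<in>words N. tcoeff a w *\<^sub>R basis_tensor w) u"
    using assms by (auto simp: trunc_tensors_iff words_def)
qed

lemma continuous_on_tcoeff [continuous_intros]:
  "continuous_on S f \<Longrightarrow> continuous_on S (\<lambda>s. tcoeff (f s) w)"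
  unfolding inner_basis_tensor[symmetric] by (intro continuous_intros)

text \<open>Only the coordinates at the finitely many words of \<open>words N\<close> enter the
  expansion, so coordinatewise continuity suffices.\<close>

lemma continuous_on_tensorI:
  fixes f :: "'b::topological_space \<Rightarrow> 'm::finite tensor"
  assumes "\<And>s. s \<in> S \<Longrightarrow> f s \<in> trunc_tensors N"
    and "\<And>w. continuous_on S (\<lambda>s. tcoeff (f s) w)"
  shows "continuous_on S f"
proof -
  have "continuous_on S (\<lambda>s. \<Sum>w\<in>words N. tcoeff (f s) w *\<^sub>R basis_tensor w)"
    by (intro continuous_on_sum continuous_on_scaleR continuous_on_const assms(2))
  then show ?thesis
    by (rule continuous_on_eq) (rule trunc_tensors_expansion[OF assms(1), symmetric])
qed

text \<open>The box is the image of a Tychonoff cube over all words under a map that uses only the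
  coordinates in \<open>words N\<close>.\<close>

lemma compact_tensor_box:
  "compact {a \<in> trunc_tensors N. \<forall>w. \<bar>tcoeff (a :: 'm::finite tensor) w\<bar> \<le> r}" (is "compact ?S")
proof -
  let ?f = "\<lambda>\<phi> :: 'm list \<Rightarrow> real. \<Sum>w\<in>words N. \<phi> w *\<^sub>R basis_tensor w"
  let ?P = "PiE UNIV (\<lambda>_ :: 'm list. {-r..r})"
  have "compactin (product_topology (\<lambda>_. euclidean) UNIV) ?P"
    by (subst compactin_PiE) simp
  then have "compact ?P"
    by (simp add: euclidean_product_topology)
  moreover have "continuous_on ?P ?f"
    by (intro continuous_intros continuous_on_product_then_coordinatewise continuous_on_id)
  ultimately have "compact (?f ` ?P)" by (rule compact_continuous_image[rotated])
  also have "?f ` ?P = ?S"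
  proof (intro equalityI subsetI)
    fix a assume a: "a \<in> ?S"
    then have "a = ?f (tcoeff a)" using trunc_tensors_expansion by auto
    moreover have "tcoeff a \<in> ?P" using a by (auto simp: abs_le_iff minus_le_iff)
    ultimately show "a \<in> ?f ` ?P" by blast
  next
    fix a assume "a \<in> ?f ` ?P"
    then obtain \<phi> where "\<phi> \<in> ?P" and a: "a = ?f \<phi>" by blast
    have \<phi>: "\<bar>\<phi> w\<bar> \<le> r" for w
      using PiE_mem[OF \<open>\<phi> \<in> ?P\<close>, of w] by (simp add: abs_le_iff minus_le_iff)
    have "tcoeff a w = (if w \<in> words N then \<phi> w else 0)" for w
      by (simp add: a if_distrib cong: if_cong)
    \<comment> \<open>Needed for the words longer than \<open>N\<close>, where the coordinate of
      \<open>a\<close> is 0.\<close>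
    moreover have "0 \<le> r" using \<phi>[of "[]"] by simp
    ultimately show "a \<in> ?S" using \<phi> by (auto simp: trunc_tensors_iff words_def)
  qed
  finally show ?thesis .
qed

lemma closed_trunc_tensors: "closed (trunc_tensors N)"
proof -
  have "trunc_tensors N = (\<Inter>w\<in>{w. N < length w}. {a. tcoeff a w = 0})"
    by (auto simp: trunc_tensors_iff)
  also have "closed \<dots>"
    by (intro closed_INT ballI closed_Collect_eq continuous_intros)
  finally show ?thesis .
qed

lemma closed_lie_grp: "closed (lie_grp N)"
  unfolding lie_grp_def
  by (intro closed_Collect_conj closed_Collect_eq continuous_intros) (simp add: closed_trunc_tensors)

lemma closed_lie_alg: "closed (lie_alg N)"
  unfolding lie_alg_def
  by (intro closed_Collect_conj closed_Collect_eq continuous_intros) (simp add: closed_trunc_tensors)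

text \<open>The exponents are even integers since \<open>length w\<close> divides \<open>fact N\<close>, so \<open>hsum N\<close> is a polynomial,
  homogeneous of degree \<open>hdeg N\<close> under dilations; it ignores the coordinate of the empty word.\<close>

definition hdeg :: "nat \<Rightarrow> nat" where
  "hdeg N = 2 * fact N"

definition hsum :: "nat \<Rightarrow> 'm::finite tensor \<Rightarrow> real" where
  "hsum N a = (\<Sum>w\<in>words N - {[]}. tcoeff a w ^ (2 * (fact N div length w)))"

definition hnorm :: "nat \<Rightarrow> 'm::finite tensor \<Rightarrow> real" where
  "hnorm N a = root (hdeg N) (hsum N a)"

lemma hdeg_pos: "0 < hdeg N"
  by (simp add: hdeg_def)

lemma hdeg_factor:
  assumes "w \<in> words N - {[]}"
  shows "length w * (2 * (fact N div length w)) = hdeg N" "0 < fact N div length w"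
proof -
  have "length w dvd fact N"
    using assms by (intro dvd_fact) (auto simp: words_def Suc_le_eq)
  then show *: "length w * (2 * (fact N div length w)) = hdeg N" by (simp add: hdeg_def)
  show "0 < fact N div length w" using * hdeg_pos[of N] by (intro gr0I) auto
qed

lemma hsum_nonneg: "0 \<le> hsum N a"
  unfolding hsum_def by (intro sum_nonneg) (simp add: power_mult)

lemma hnorm_nonneg: "0 \<le> hnorm N a"
  by (simp add: hnorm_def hsum_nonneg real_root_ge_zero)

lemma hnorm_power: "hnorm N a ^ hdeg N = hsum N a"
  unfolding hnorm_def using hdeg_pos hsum_nonneg by (rule real_root_pow_pos2)

lemma continuous_on_hsum [continuous_intros]:
  "continuous_on S f \<Longrightarrow> continuous_on S (\<lambda>s. hsum N (f s))"
  unfolding hsum_def by (intro continuous_intros)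

lemma continuous_on_hnorm [continuous_intros]:
  "continuous_on S f \<Longrightarrow> continuous_on S (\<lambda>s. hnorm N (f s))"
  unfolding hnorm_def by (intro continuous_intros)

text \<open>A single summand is at most \<open>q ^ hdeg N = (q ^ length w) ^ p\<close>, and the
  \<open>p\<close>-th root is monotone. A free \<open>q\<close> lets the bound serve for
  \<open>hnorm\<close> as well as for \<open>hroot\<close>.\<close>

lemma tcoeff_le_if_hsum_le:
  assumes w: "w \<in> words N - {[]}" and "0 \<le> q" "hsum N a \<le> q ^ hdeg N"
  shows "\<bar>tcoeff a w\<bar> \<le> q ^ length w"
proof -
  define p where "p = 2 * (fact N div length w)"
  have p: "length w * p = hdeg N" "0 < p" using hdeg_factor[OF w] by (auto simp: p_def)
  have "\<bar>tcoeff a w\<bar> ^ p = tcoeff a w ^ p" by (simp add: p_def power_mult)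
  also have "\<dots> \<le> hsum N a"
    unfolding hsum_def p_def
    by (rule member_le_sum[OF w, of "\<lambda>w. tcoeff a w ^ (2 * (fact N div length w))"])
       (auto simp: power_mult)
  also have "\<dots> \<le> (q ^ length w) ^ p" using assms(3) p(1) by (simp flip: power_mult)
  finally show ?thesis using assms(2) p(2) by (simp add: power_mono_iff)
qed

lemma tcoeff_le_hnorm:
  "w \<in> words N - {[]} \<Longrightarrow> \<bar>tcoeff a w\<bar> \<le> hnorm N a ^ length w"
  by (rule tcoeff_le_if_hsum_le) (auto simp: hnorm_nonneg hnorm_power)

text \<open>A converse to the previous bounds, up to the number of words. It allows
  \<open>hnorm\<close> to be compared across different truncation levels, where the exponents
  differ.\<close>

lemma hsum_le:
  fixes a :: "'m::finite tensor" and q :: real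
  assumes "0 \<le> q" "\<And>w. w \<in> words N - {[]} \<Longrightarrow> \<bar>tcoeff a w\<bar> \<le> q ^ length w"
  shows "hsum N a \<le> real (card (words N :: 'm list set)) * q ^ hdeg N"
proof -
  have "hsum N a \<le> (\<Sum>w\<in>(words N - {[]} :: 'm list set). q ^ hdeg N)"
    unfolding hsum_def
  proof (rule sum_mono)
    fix w :: "'m list" assume w: "w \<in> words N - {[]}"
    define p where "p = 2 * (fact N div length w)"
    have "tcoeff a w ^ p = \<bar>tcoeff a w\<bar> ^ p" by (simp add: p_def power_mult)
    also have "\<dots> \<le> (q ^ length w) ^ p" using assms(2)[OF w] by (intro power_mono) auto
    also have "\<dots> = q ^ hdeg N" using hdeg_factor(1)[OF w] by (simp add: p_def flip: power_mult)
    finally show "tcoeff a w ^ (2 * (fact N div length w)) \<le> q ^ hdeg N" by (simp add: p_def)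
  qed
  also have "\<dots> = real (card (words N - {[]} :: 'm list set)) * q ^ hdeg N" by simp
  also have "\<dots> \<le> real (card (words N :: 'm list set)) * q ^ hdeg N"
    using assms(1) card_mono[of "words N :: 'm list set" "words N - {[]}"]
    by (intro mult_right_mono) auto
  finally show ?thesis .
qed

lemma hsum_dilation:
  fixes a :: "'m::finite tensor"
  shows "hsum N (dilation c a) = c ^ hdeg N * hsum N a"
  unfolding hsum_def sum_distrib_left
proof (rule sum.cong)
  fix w :: "'m list" assume "w \<in> words N - {[]}"
  from hdeg_factor(1)[OF this]
  show "tcoeff (dilation c a) w ^ (2 * (fact N div length w))
      = c ^ hdeg N * tcoeff a w ^ (2 * (fact N div length w))"
    by (simp add: power_mult_distrib flip: power_mult)
qed simp

lemma hnorm_dilation: "0 \<le> c \<Longrightarrow> hnorm N (dilation c a) = c * hnorm N a"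
  using hdeg_pos[of N] by (simp add: hnorm_def hsum_dilation real_root_mult real_root_power_cancel)

lemma tcoeff_eq_0_if_hnorm_eq_0:
  "hnorm N a = 0 \<Longrightarrow> w \<in> words N - {[]} \<Longrightarrow> tcoeff a w = 0"
  using tcoeff_le_hnorm[of w N a] by (cases w) auto

lemma dilation_in_lie_grp: "a \<in> lie_grp N \<Longrightarrow> dilation c a \<in> lie_grp N"
  by (auto simp: lie_grp_def trunc_tensors_iff)

lemma dilation_in_lie_alg: "a \<in> lie_alg N \<Longrightarrow> dilation c a \<in> lie_alg N"
  by (auto simp: lie_alg_def trunc_tensors_iff)

lemma compact_if_tcoeff_le:
  fixes S :: "'m::finite tensor set"
  assumes "closed S" "S \<subseteq> trunc_tensors N"
    and "\<And>a. a \<in> S \<Longrightarrow> \<bar>tcoeff a []\<bar> \<le> 1" "\<And>a. a \<in> S \<Longrightarrow> hnorm N a \<le> q"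
  shows "compact S"
proof -
  \<comment> \<open>With base at least 1, the exponent \<open>N\<close> covers all word lengths up
    to \<open>N\<close>.\<close>
  define r where "r = max 1 q ^ N"
  have r: "1 \<le> r" by (simp add: r_def)
  have "\<bar>tcoeff a w\<bar> \<le> r" if a: "a \<in> S" for a and w :: "'m list"
  proof (cases "w \<in> words N - {[]}")
    case True
    have "\<bar>tcoeff a w\<bar> \<le> hnorm N a ^ length w" using tcoeff_le_hnorm[OF True] .
    also have "\<dots> \<le> max 1 q ^ length w"
      using assms(4)[OF a] hnorm_nonneg by (intro power_mono) auto
    also have "\<dots> \<le> r" using True unfolding r_def by (intro power_increasing) (auto simp: words_def)
    finally show ?thesis .
  next
    case False
    show ?thesis
    proof (cases "w = []")
      case True
      then show ?thesis using assms(3)[OF a] r by simp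
    next
      case False
      with \<open>w \<notin> words N - {[]}\<close> have "tcoeff a w = 0"
        using a assms(2) by (auto simp: words_def trunc_tensors_iff)
      then show ?thesis using r by simp
    qed
  qed
  then have "S \<subseteq> {a \<in> trunc_tensors N. \<forall>w. \<bar>tcoeff a w\<bar> \<le> r}" using assms(2) by auto
  then show ?thesis
    using compact_Int_closed[OF compact_tensor_box[of N r] assms(1)] by (simp only: Int_absorb1)
qed

lemma compact_lie_grp_le: "compact {a \<in> lie_grp N. hnorm N a \<le> q}"
proof (rule compact_if_tcoeff_le)
  show "closed {a \<in> lie_grp N. hnorm N (a :: 'a tensor) \<le> q}"
    by (intro closed_Collect_conj closed_Collect_le continuous_intros) (simp add: closed_lie_grp)
qed (auto simp: lie_grp_def)

lemma compact_lie_alg_le: "compact {a \<in> lie_alg N. hnorm N a \<le> q}"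
proof (rule compact_if_tcoeff_le)
  show "closed {a \<in> lie_alg N. hnorm N (a :: 'a tensor) \<le> q}"
    by (intro closed_Collect_conj closed_Collect_le continuous_intros) (simp add: closed_lie_alg)
qed (auto simp: lie_alg_def)

section \<open>Comparison of arbitrary gauges with \<open>hnorm\<close>\<close>

lemma homogeneous_gaugeD:
  assumes "homogeneous_gauge n h"
  shows "continuous_on (lie_grp n) h" "\<And>g. g \<in> lie_grp n \<Longrightarrow> 0 \<le> h g"
    "\<And>g. g \<in> lie_grp n \<Longrightarrow> h g = 0 \<longleftrightarrow> g = tone"
    "\<And>g c. g \<in> lie_grp n \<Longrightarrow> 0 < c \<Longrightarrow> h (dilation c g) = c * h g"
  using assms unfolding homogeneous_gauge_def by auto

lemma gauge_le_hnorm: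
  fixes h :: "'m::finite tensor \<Rightarrow> real"
  assumes h: "homogeneous_gauge n h"
  obtains C where "0 \<le> C" "\<And>g. g \<in> lie_grp n \<Longrightarrow> h g \<le> C * hnorm n g"
proof -
  let ?S = "{g :: 'm tensor. g \<in> lie_grp n \<and> hnorm n g \<le> 1}"
  have "compact (h ` ?S)"
    by (intro compact_continuous_image continuous_on_subset[OF homogeneous_gaugeD(1)[OF h]]
        compact_lie_grp_le) auto
  then have "bounded (h ` ?S)" by (rule compact_imp_bounded)
  then obtain C where C: "\<And>g. g \<in> ?S \<Longrightarrow> \<bar>h g\<bar> \<le> C" by (auto simp: bounded_iff)
  show thesis
  proof (rule that[of "max 0 C"])
    fix g :: "'m tensor" assume g: "g \<in> lie_grp n"
    show "h g \<le> max 0 C * hnorm n g"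
    proof (cases "hnorm n g = 0")
      \<comment> \<open>Normalising by a dilation is impossible here, but \<open>g\<close> must be
        \<open>tone\<close>, where both sides vanish.\<close>
      case True
      have "tcoeff g w = tcoeff tone w" for w
        using tcoeff_eq_0_if_hnorm_eq_0[OF True, of w] g
        by (cases "w \<in> words n - {[]}") (auto simp: lie_grp_def trunc_tensors_iff words_def)
      then have "g = tone" by (rule tensor_eqI)
      then show ?thesis using homogeneous_gaugeD(3)[OF h g] True by simp
    next
      case False
      define r where "r = hnorm n g"
      have r: "0 < r" using False hnorm_nonneg[of n g] by (simp add: r_def)
      have "dilation (1 / r) g \<in> ?S"
        using g r by (simp add: dilation_in_lie_grp hnorm_dilation r_def)
      then have "h (dilation (1 / r) g) \<le> max 0 C" using C by fastforce
      then show ?thesis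
        using homogeneous_gaugeD(4)[OF h g, of "1 / r"] r by (simp add: r_def[symmetric] field_simps)
    qed
  qed simp
qed

section \<open>Dilations and the truncated exponential\<close>

lemma dilation_tmult: "dilation c (tmult N a b) = tmult N (dilation c a) (dilation c b)"
proof (rule tensor_eqI)
  fix w
  \<comment> \<open>Prefix and suffix lengths add up to \<open>length w\<close>, which is why
    dilations are multiplicative.\<close>
  have eq: "c ^ length w * (tcoeff a (take k w) * tcoeff b (drop k w))
      = c ^ k * tcoeff a (take k w) * (c ^ (length w - k) * tcoeff b (drop k w))" if "k \<le> length w" for k
  proof -
    have "c ^ length w = c ^ k * c ^ (length w - k)" using that by (simp flip: power_add)
    then show ?thesis by simp
  qed
  have "(\<Sum>k\<le>length w. c ^ length w * (tcoeff a (take k w) * tcoeff b (drop k w)))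
      = (\<Sum>k\<le>length w. c ^ k * tcoeff a (take k w) * (c ^ (length w - k) * tcoeff b (drop k w)))"
    by (rule sum.cong[OF refl eq]) simp
  then show "tcoeff (dilation c (tmult N a b)) w = tcoeff (tmult N (dilation c a) (dilation c b)) w"
    by (simp add: tcoeff_tmult sum_distrib_left min_absorb2)
qed

lemma dilation_tone: "dilation c tone = tone"
  by (rule tensor_eqI) simp

lemma dilation_tpow: "dilation c (tpow N a k) = tpow N (dilation c a) k"
  by (induction k) (auto simp: dilation_tone dilation_tmult)

lemma dilation_texp: "dilation c (texp N a) = texp N (dilation c a)"
  by (rule tensor_eqI) (simp add: texp_def sum_distrib_left mult.left_commute flip: dilation_tpow)

lemma tcoeff_tpow_Nil: "tcoeff a [] = 0 \<Longrightarrow> tcoeff (tpow N a k) [] = (if k = 0 then 1 else 0)"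
  by (cases k) (auto simp: tcoeff_tmult)

lemma tcoeff_tpow_long: "N < length w \<Longrightarrow> tcoeff (tpow N a k) w = 0"
  by (cases k) (auto simp: tcoeff_tmult)

lemma texp_in_lie_grp: "a \<in> lie_alg N \<Longrightarrow> texp N a \<in> lie_grp N"
  by (auto simp: lie_grp_def lie_alg_def trunc_tensors_iff texp_def tcoeff_tpow_long tcoeff_tpow_Nil
      if_distrib cong: if_cong)

lemma continuous_on_tcoeff_tpow: "continuous_on S (\<lambda>a. tcoeff (tpow N a k) w)"
proof (induction k arbitrary: w)
  case (Suc k)
  show ?case
    by (cases "length w \<le> N") (auto simp: tcoeff_tmult intro!: continuous_intros Suc.IH)
qed simp

lemma continuous_on_texp: "continuous_on (lie_alg N) (texp N)"
proof (rule continuous_on_tensorI)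
  show "texp N a \<in> trunc_tensors N" if "a \<in> lie_alg N" for a
    using texp_in_lie_grp[OF that] by (simp add: lie_grp_def)
  show "continuous_on (lie_alg N) (\<lambda>a. tcoeff (texp N a) w)" for w
    by (auto simp: texp_def intro!: continuous_intros continuous_on_tcoeff_tpow)
qed

text \<open>In the lowest level where \<open>a\<close> does not vanish only the linear term of the exponential
  contributes.\<close>

lemma texp_eq_tone_imp:
  fixes a :: "'m::finite tensor"
  assumes a: "a \<in> lie_alg N" and eq: "texp N a = tone"
  shows "a = 0"
proof -
  have "tcoeff a w = 0" for w
  proof (induction w rule: length_induct)
    case (1 w)
    show ?case
    proof (cases "w \<in> words N - {[]}")
      case True
      have less: "tcoeff a (take k w) = 0" if "k < length w" for k
        using 1 that by simp
      \<comment> \<open>The induction hypothesis removes every splitting with a proper prefix. The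
        remaining one leaves the empty suffix, where \<open>tpow N a k\<close> is nonzero only for
        \<open>k = 0\<close>.\<close>
      have pow: "tcoeff (tpow N a (Suc k)) w = (if k = 0 then tcoeff a w else 0)" for k
      proof -
        have "tcoeff (tpow N a (Suc k)) w
            = (\<Sum>i\<le>length w. tcoeff a (take i w) * tcoeff (tpow N a k) (drop i w))"
          using True by (simp add: tcoeff_tmult words_def)
        also have "\<dots> = (\<Sum>i\<in>{length w}. tcoeff a (take i w) * tcoeff (tpow N a k) (drop i w))"
          using less by (intro sum.mono_neutral_right) auto
        also have "\<dots> = (if k = 0 then tcoeff a w else 0)"
          using a by (simp add: tcoeff_tpow_Nil lie_alg_def)
        finally show ?thesis .
      qed
      have "0 < N" using True by (cases N) (auto simp: words_def)
      have "tcoeff (texp N a) w = (\<Sum>k\<le>N. 1 / fact k * tcoeff (tpow N a k) w)" by (simp add: texp_def)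
      also have "\<dots> = (\<Sum>k\<in>{1}. 1 / fact k * tcoeff (tpow N a k) w)"
      proof (rule sum.mono_neutral_right)
        show "\<forall>k\<in>{..N} - {1}. 1 / fact k * tcoeff (tpow N a k) w = 0"
        proof
          fix k assume "k \<in> {..N} - {1}"
          then show "1 / fact k * tcoeff (tpow N a k) w = 0"
            using True pow by (cases k) (auto simp del: tpow.simps(2))
        qed
      qed (use \<open>0 < N\<close> in auto)
      also have "\<dots> = tcoeff a w" using pow[of 0] by simp
      finally show ?thesis using eq True by simp
    next
      case False
      then show ?thesis using a by (auto simp: lie_alg_def trunc_tensors_iff words_def)
    qed
  qed
  then show ?thesis by (intro tensor_eqI) simp
qed

text \<open>On the unit sphere of the Lie algebra \<open>lie_gauge n h\<close> is positive by
  \<open>texp_eq_tone_imp\<close>, hence bounded below by some \<open>c > 0\<close>. As dilations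
  commute with \<open>texp\<close>, this scales to the constant \<open>1 / c\<close>.\<close>

lemma hnorm_le_lie_gauge:
  fixes h :: "'m::finite tensor \<Rightarrow> real"
  assumes h: "homogeneous_gauge n h"
  obtains C where "0 < C" "\<And>a. a \<in> lie_alg n \<Longrightarrow> hnorm n a \<le> C * lie_gauge n h a"
proof -
  let ?S = "{a :: 'm tensor. a \<in> lie_alg n \<and> hnorm n a \<le> 1} \<inter> {a. hnorm n a = 1}"
  have comp: "compact ?S"
    by (intro compact_Int_closed compact_lie_alg_le closed_Collect_eq continuous_intros)
  have cont: "continuous_on ?S (lie_gauge n h)"
    unfolding lie_gauge_def
    by (rule continuous_on_compose2[OF homogeneous_gaugeD(1)[OF h]
          continuous_on_subset[OF continuous_on_texp[of n]]]) (auto simp: texp_in_lie_grp)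
  have pos: "0 < lie_gauge n h a" if "a \<in> ?S" for a
  proof -
    have a: "a \<in> lie_alg n" "hnorm n a = 1" using that by auto
    have "texp n a \<noteq> tone"
    proof
      assume "texp n a = tone"
      \<comment> \<open>Writing 0 as a dilation by the factor 0 lets \<open>hnorm_dilation\<close>
        show that its norm is 0.\<close>
      then have "a = dilation 0 0" using texp_eq_tone_imp[OF a(1)] by (auto intro: tensor_eqI)
      then show False using a(2) by (simp add: hnorm_dilation)
    qed
    then show ?thesis
      using homogeneous_gaugeD(2,3)[OF h texp_in_lie_grp[OF a(1)]] by (simp add: lie_gauge_def)
  qed
  obtain c where c: "0 < c" "\<And>a. a \<in> ?S \<Longrightarrow> c \<le> lie_gauge n h a"
  proof (cases "?S = {}")
    \<comment> \<open>For \<open>n = 0\<close> the sphere is empty and any positive constant will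
      do.\<close>
    case True
    then have "1 \<le> lie_gauge n h a" if "a \<in> ?S" for a using that by blast
    then show ?thesis by (rule that[OF zero_less_one])
  next
    case False
    obtain b where b: "b \<in> ?S" "\<forall>a\<in>?S. lie_gauge n h b \<le> lie_gauge n h a"
      using continuous_attains_inf[OF comp False cont] by (rule bexE)
    show ?thesis by (rule that[OF pos[OF b(1)] bspec[OF b(2)]])
  qed
  show thesis
  proof (rule that[of "1 / c"])
    fix a :: "'m tensor" assume a: "a \<in> lie_alg n"
    show "hnorm n a \<le> 1 / c * lie_gauge n h a"
    proof (cases "hnorm n a = 0")
      case True
      then show ?thesis
        using c(1) homogeneous_gaugeD(2)[OF h texp_in_lie_grp[OF a]] by (simp add: lie_gauge_def)
    next
      case False
      define r where "r = hnorm n a"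
      have r: "0 < r" using False hnorm_nonneg[of n a] by (simp add: r_def)
      have "dilation (1 / r) a \<in> ?S"
        using a r by (simp add: dilation_in_lie_alg hnorm_dilation r_def)
      then have "c \<le> lie_gauge n h (dilation (1 / r) a)" by (rule c(2))
      also have "\<dots> = 1 / r * lie_gauge n h a"
        using homogeneous_gaugeD(4)[OF h texp_in_lie_grp[OF a], of "1 / r"] r
        by (simp add: lie_gauge_def flip: dilation_texp)
      finally show ?thesis using r c(1) by (simp add: r_def[symmetric] field_simps)
    qed
  qed (use c in simp)
qed

section \<open>The Lyapunov estimate\<close>

text \<open>After division by \<open>Q = (1 + \<epsilon>) * q\<close> both \<open>a\<close> and
  \<open>a + b\<close> lie in the unit interval around 0, where the \<open>p\<close>-th power has
  Lipschitz constant \<open>p\<close>; scaling back produces the factor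
  \<open>(1 + \<epsilon>) ^ p\<close>.\<close>

lemma power_add_le:
  fixes a b q \<epsilon> :: real
  assumes "\<bar>a\<bar> \<le> q" "\<bar>b\<bar> \<le> \<epsilon> * q" "0 \<le> \<epsilon>"
  shows "(a + b) ^ p \<le> a ^ p + real p * \<epsilon> * (1 + \<epsilon>) ^ p * q ^ p"
proof (cases "q = 0")
  case True
  then show ?thesis using assms by simp
next
  case False
  then have q: "0 < q" using assms(1) by linarith
  define Q where "Q = (1 + \<epsilon>) * q"
  have Q: "0 < Q" "q \<le> Q" using q assms(3) by (auto simp: Q_def)
  have "\<bar>a + b\<bar> \<le> Q" using assms(1,2) by (simp add: Q_def algebra_simps)
  moreover have "\<bar>a\<bar> \<le> Q" using assms(1) Q(2) by linarith
  ultimately have "norm (((a + b) / Q) ^ p - (a / Q) ^ p) \<le> real p * norm ((a + b) / Q - a / Q)"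
    using Q(1) by (intro norm_power_diff) auto
  also have "\<dots> = real p * (\<bar>b\<bar> / Q)" using Q(1) by (simp add: diff_divide_distrib[symmetric])
  also have "\<dots> \<le> real p * \<epsilon>"
  proof (rule mult_left_mono)
    have "\<bar>b\<bar> \<le> \<epsilon> * Q" using assms(2) mult_left_mono[OF Q(2) assms(3)] by linarith
    then show "\<bar>b\<bar> / Q \<le> \<epsilon>" using Q(1) by (simp add: divide_le_eq)
  qed simp
  finally have "((a + b) ^ p - a ^ p) / Q ^ p \<le> real p * \<epsilon>"
    by (simp add: power_divide diff_divide_distrib)
  then have "(a + b) ^ p - a ^ p \<le> real p * \<epsilon> * Q ^ p"
    using Q(1) by (simp add: divide_le_eq)
  then show ?thesis by (simp add: Q_def power_mult_distrib mult_ac)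
qed

text \<open>The root of \<open>1 + hsum N a\<close> dominates both \<open>1\<close> and \<open>hnorm N a\<close>, so that its powers bound all
  coordinates of a group element, including the one of the empty word.\<close>

definition hroot :: "nat \<Rightarrow> 'm::finite tensor \<Rightarrow> real" where
  "hroot N a = root (hdeg N) (1 + hsum N a)"

lemma hroot_power: "hroot N a ^ hdeg N = 1 + hsum N a"
  unfolding hroot_def using hsum_nonneg[of N a] by (intro real_root_pow_pos2 hdeg_pos) simp

lemma hroot_ge_1: "1 \<le> hroot N a"
  unfolding hroot_def using hsum_nonneg[of N a] hdeg_pos by simp

lemma hnorm_le_hroot: "hnorm N a \<le> hroot N a"
  unfolding hroot_def hnorm_def using hdeg_pos by (intro real_root_le_mono) auto

lemma tcoeff_le_hroot:
  assumes "a \<in> lie_grp N"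
  shows "\<bar>tcoeff a w\<bar> \<le> hroot N a ^ length w"
proof (cases "w \<in> words N - {[]}")
  case True
  then show ?thesis
    using hroot_ge_1[of N a] by (intro tcoeff_le_if_hsum_le) (auto simp: hroot_power)
next
  case False
  then have "\<bar>tcoeff a w\<bar> \<le> 1"
    using assms by (auto simp: lie_grp_def trunc_tensors_iff words_def)
  also have "\<dots> \<le> hroot N a ^ length w" using hroot_ge_1 by (rule one_le_power)
  finally show ?thesis .
qed

text \<open>Each of the at most \<open>Suc N\<close> splittings of \<open>w\<close> into
  \<open>u\<close> and \<open>v\<close> contributes at most \<open>D\<close> times
  \<open>hroot N a\<close> to the power \<open>length u + length v = length w\<close>.\<close>

lemma tcoeff_tmult_le:
  assumes "a \<in> lie_grp N" "0 \<le> D"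
    and b: "\<And>w. \<bar>tcoeff b w\<bar> \<le> D * hroot N a ^ length w"
  shows "\<bar>tcoeff (tmult N a b) w\<bar> \<le> real (Suc N) * D * hroot N a ^ length w"
proof (cases "length w \<le> N")
  case True
  let ?R = "hroot N a"
  have R: "0 \<le> ?R" using hroot_ge_1[of N a] by simp
  have "\<bar>tcoeff (tmult N a b) w\<bar> \<le> (\<Sum>k\<le>length w. \<bar>tcoeff a (take k w)\<bar> * \<bar>tcoeff b (drop k w)\<bar>)"
    using True by (simp add: tcoeff_tmult sum_abs flip: abs_mult)
  also have "\<dots> \<le> (\<Sum>k\<le>length w. D * ?R ^ length w)"
  proof (rule sum_mono)
    fix k assume k: "k \<in> {..length w}"
    have "\<bar>tcoeff a (take k w)\<bar> * \<bar>tcoeff b (drop k w)\<bar> \<le> ?R ^ k * (D * ?R ^ (length w - k))"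
      using tcoeff_le_hroot[OF assms(1), of "take k w"] b[of "drop k w"] R k
      by (intro mult_mono) (auto simp: min_absorb2)
    also have "\<dots> = D * ?R ^ length w" using k by (simp flip: power_add)
    finally show "\<bar>tcoeff a (take k w)\<bar> * \<bar>tcoeff b (drop k w)\<bar> \<le> D * ?R ^ length w" .
  qed
  also have "\<dots> = real (Suc (length w)) * (D * ?R ^ length w)" by simp
  also have "\<dots> \<le> real (Suc N) * (D * ?R ^ length w)"
    using True assms(2) R by (intro mult_right_mono) auto
  finally show ?thesis by (simp add: mult.assoc)
next
  case False
  then show ?thesis using assms(2) hroot_ge_1[of N a] by (simp add: tcoeff_tmult)
qed

text \<open>Homogeneity makes the error independent of the word: the bound
  \<open>hroot N a ^ length w\<close>, raised to the exponent belonging to \<open>w\<close>, is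
  always \<open>1 + hsum N a\<close>. The cap \<open>\<epsilon>0\<close> keeps the constant uniform,
  so that the estimate is linear in \<open>\<epsilon>\<close>.\<close>

lemma hsum_add_le:
  fixes a b :: "'m::finite tensor"
  assumes a: "a \<in> lie_grp N" and \<epsilon>: "0 \<le> \<epsilon>" "\<epsilon> \<le> \<epsilon>0"
    and b: "\<And>w. \<bar>tcoeff b w\<bar> \<le> \<epsilon> * hroot N a ^ length w"
  shows "hsum N (a + b) \<le> hsum N a
    + real (card (words N :: 'm list set)) * hdeg N * (1 + \<epsilon>0) ^ hdeg N * \<epsilon> * (1 + hsum N a)"
proof -
  define E where "E = real (hdeg N) * \<epsilon> * (1 + \<epsilon>0) ^ hdeg N * (1 + hsum N a)"
  have E: "0 \<le> E" using \<epsilon> hsum_nonneg[of N a] by (simp add: E_def)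
  have "tcoeff (a + b) w ^ p \<le> tcoeff a w ^ p + E"
    if w: "w \<in> words N - {[]}" and p: "p = 2 * (fact N div length w)" for w p
  proof -
    have wp: "length w * p = hdeg N" using hdeg_factor(1)[OF w] p by simp
    have "w \<noteq> []" using w by simp
    then have "1 * p \<le> length w * p" by (intro mult_right_mono) (auto simp: Suc_le_eq)
    then have p_le: "p \<le> hdeg N" using wp by simp
    have "tcoeff (a + b) w ^ p
        \<le> tcoeff a w ^ p + real p * \<epsilon> * (1 + \<epsilon>) ^ p * (hroot N a ^ length w) ^ p"
      unfolding tcoeff_simps by (intro power_add_le tcoeff_le_hroot a b \<epsilon>)
    also have "(hroot N a ^ length w) ^ p = 1 + hsum N a"
      by (simp add: wp hroot_power flip: power_mult)
    also have "real p * \<epsilon> * (1 + \<epsilon>) ^ p \<le> real (hdeg N) * \<epsilon> * (1 + \<epsilon>0) ^ hdeg N"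
    proof (intro mult_mono)
      have "(1 + \<epsilon>) ^ p \<le> (1 + \<epsilon>0) ^ p" using \<epsilon> by (intro power_mono) auto
      also have "\<dots> \<le> (1 + \<epsilon>0) ^ hdeg N" using \<epsilon> p_le by (intro power_increasing) auto
      finally show "(1 + \<epsilon>) ^ p \<le> (1 + \<epsilon>0) ^ hdeg N" .
    qed (use \<epsilon> p_le in auto)
    finally show ?thesis using hsum_nonneg[of N a] by (simp add: E_def mult_right_mono)
  qed
  then have "hsum N (a + b) \<le> (\<Sum>w\<in>(words N - {[]} :: 'm list set). tcoeff a w ^ (2 * (fact N div length w)) + E)"
    unfolding hsum_def by (intro sum_mono) blast
  also have "\<dots> = hsum N a + real (card (words N - {[]} :: 'm list set)) * E"
    by (simp add: hsum_def sum.distrib)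
  also have "\<dots> \<le> hsum N a + real (card (words N :: 'm list set)) * E"
    using card_mono[of "words N :: 'm list set" "words N - {[]}"] E
    by (intro add_left_mono mult_right_mono) auto
  finally show ?thesis by (simp add: E_def mult_ac)
qed

lemma tmult_in_trunc_tensors: "tmult N a b \<in> trunc_tensors N"
  by (simp add: trunc_tensors_iff tcoeff_tmult)

lemma tmult_in_lie_alg: "b \<in> lie_alg N \<Longrightarrow> tmult N a b \<in> lie_alg N"
  by (simp add: lie_alg_def tmult_in_trunc_tensors tcoeff_tmult)

lemma sum_lie_alg_in_lie_grp:
  assumes "a \<in> lie_grp N" "\<And>j. j \<in> J \<Longrightarrow> b j \<in> lie_alg N"
  shows "a + (\<Sum>j\<in>J. c j *\<^sub>R b j) \<in> lie_grp N"
  using assms by (auto simp: lie_grp_def lie_alg_def trunc_tensors_iff)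

lemma continuous_on_tmult:
  assumes "continuous_on S f" "continuous_on S g"
  shows "continuous_on S (\<lambda>s. tmult N (f s) (g s))"
proof (rule continuous_on_tensorI)
  show "continuous_on S (\<lambda>s. tcoeff (tmult N (f s) (g s)) w)" for w
    using assms by (cases "length w \<le> N") (auto simp: tcoeff_tmult intro!: continuous_intros)
qed (rule tmult_in_trunc_tensors)

text \<open>The condition \<open>growth\<close> is the common form to which both hypotheses of the
  theorem are reduced. Left multiplication by \<open>a\<close> preserves its homogeneity, so
  \<open>1 + hsum N\<close> is a Lyapunov function for the Euler steps of \<open>G\<close>.\<close>

lemma cde_solution_exists:
  fixes T :: real
    and x :: "real \<Rightarrow> real ^ 'd"
    and S0 :: "'m::finite tensor"
    and F :: "'m tensor \<Rightarrow> (real ^ 'd) \<Rightarrow>\<^sub>L 'm tensor"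
  assumes T: "0 < T"
    and x: "L-lipschitz_on {0..T} x"
    and S0: "S0 \<in> lie_grp N"
    and F_cont: "continuous_on (lie_grp N) F"
    and F_range: "\<And>a v. a \<in> lie_grp N \<Longrightarrow> blinfun_apply (F a) v \<in> lie_alg N"
    and D: "0 \<le> D"
    and growth: "\<And>a j w. a \<in> lie_grp N \<Longrightarrow> w \<in> words N - {[]} \<Longrightarrow>
      \<bar>tcoeff (blinfun_column F j a) w\<bar> \<le> D * (1 + hnorm N a) ^ length w"
  shows "\<exists>S. cde_solution N F x S0 T S"
proof -
  define G where "G j a = tmult N a (blinfun_column F j a)" for j a
  \<comment> \<open>The factors count the columns, the splittings of a word, and the cost
    \<open>2 ^ N\<close> of replacing \<open>1 + hnorm N a\<close> by
    \<open>2 * hroot N a\<close>.\<close>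
  define E where "E = real CARD('d) * (real (Suc N) * (D * 2 ^ N))"
  have E: "0 \<le> E" using D by (simp add: E_def)
  have L: "0 \<le> L" using x by (rule lipschitz_on_nonneg)
  have column_in: "blinfun_column F j a \<in> lie_alg N" if "a \<in> lie_grp N" for j a
    unfolding blinfun_column_def using F_range[OF that] .
  have G_in: "G j a \<in> lie_alg N" if "a \<in> lie_grp N" for j a
    unfolding G_def using column_in[OF that] by (rule tmult_in_lie_alg)
  have column_le: "\<bar>tcoeff (blinfun_column F j a) w\<bar> \<le> D * 2 ^ N * hroot N a ^ length w"
    if a: "a \<in> lie_grp N" for j a w
  proof (cases "w \<in> words N - {[]}")
    case True
    have "\<bar>tcoeff (blinfun_column F j a) w\<bar> \<le> D * (1 + hnorm N a) ^ length w"
      using growth[OF a True] .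
    also have "\<dots> \<le> D * (2 * hroot N a) ^ length w"
      using hroot_ge_1[of N a] hnorm_le_hroot[of N a] hnorm_nonneg[of N a] D
      by (intro mult_left_mono power_mono) auto
    also have "\<dots> = D * 2 ^ length w * hroot N a ^ length w" by (simp add: power_mult_distrib)
    also have "\<dots> \<le> D * 2 ^ N * hroot N a ^ length w"
      using D True hroot_ge_1[of N a]
      by (intro mult_right_mono mult_left_mono power_increasing) (auto simp: words_def)
    finally show ?thesis .
  next
    case False
    then have "tcoeff (blinfun_column F j a) w = 0"
      using column_in[OF a] by (auto simp: lie_alg_def trunc_tensors_iff words_def)
    then show ?thesis using D hroot_ge_1[of N a] by simp
  qed
  have incr_le: "\<bar>tcoeff (\<Sum>j\<in>UNIV. v $ j *\<^sub>R G j a) w\<bar> \<le> E * norm v * hroot N a ^ length w"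
    if a: "a \<in> lie_grp N" for a and v :: "real ^ 'd" and w
  proof -
    have "\<bar>tcoeff (\<Sum>j\<in>UNIV. v $ j *\<^sub>R G j a) w\<bar> \<le> (\<Sum>j\<in>UNIV. \<bar>v $ j\<bar> * \<bar>tcoeff (G j a) w\<bar>)"
      by (simp add: sum_abs flip: abs_mult)
    also have "\<dots> \<le> (\<Sum>j\<in>(UNIV :: 'd set). norm v * (real (Suc N) * (D * 2 ^ N) * hroot N a ^ length w))"
      unfolding G_def using D column_le[OF a] component_le_norm_cart[of v]
      by (intro sum_mono mult_mono tcoeff_tmult_le a) auto
    also have "\<dots> = E * norm v * hroot N a ^ length w" by (simp add: E_def mult_ac)
    finally show ?thesis .
  qed
  \<comment> \<open>This is the constant of \<open>hsum_add_le\<close> for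
    \<open>\<epsilon> = E * norm v\<close> and the cap \<open>E * (L * T)\<close>, with
    \<open>norm v\<close> split off.\<close>
  define c where "c = real (card (words N :: 'm list set)) * hdeg N * (1 + E * (L * T)) ^ hdeg N * E"
  have column_cont: "continuous_on (lie_grp N) (blinfun_column F j)" for j
    unfolding blinfun_column_def
    by (intro continuous_intros F_cont)
  have expansion: "a = (\<Sum>v\<in>basis_tensor ` words N. inner a v *\<^sub>R v)"
    if "a \<in> trunc_tensors N" for a :: "'m tensor"
  proof -
    have "inj_on basis_tensor (words N :: 'm list set)"
      by (rule inj_onI) (metis tcoeff_basis_tensor zero_neq_one)
    then show ?thesis
      using trunc_tensors_expansion[OF that] by (simp add: sum.reindex inner_basis_tensor)
  qed
  interpret euler_scheme T L c x G "lie_grp N" "basis_tensor ` words N" "\<lambda>a. 1 + hsum N a" S0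
  proof
    show "0 \<le> c" using E L T by (simp add: c_def)
    show "compact {a \<in> lie_grp N. 1 + hsum N (a :: 'm tensor) \<le> r}" for r
    proof (rule compact_if_tcoeff_le)
      show "closed {a \<in> lie_grp N. 1 + hsum N (a :: 'm tensor) \<le> r}"
        by (intro closed_Collect_conj closed_Collect_le continuous_intros) (simp add: closed_lie_grp)
      show "hnorm N a \<le> root (hdeg N) r" if "a \<in> {a \<in> lie_grp N. 1 + hsum N a \<le> r}" for a :: "'m tensor"
        using that unfolding hnorm_def by (intro real_root_le_mono hdeg_pos) auto
    qed (auto simp: lie_grp_def)
    show "a = (\<Sum>v\<in>basis_tensor ` words N. inner a v *\<^sub>R v)" if "a \<in> lie_grp N" for a :: "'m tensor"
      using that by (intro expansion) (simp add: lie_grp_def)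
    show "G j a = (\<Sum>v\<in>basis_tensor ` words N. inner (G j a) v *\<^sub>R v)" if "a \<in> lie_grp N" for j a
      using G_in[OF that] by (intro expansion) (simp add: lie_alg_def)
    show "continuous_on (lie_grp N) (G j)" for j
      unfolding G_def by (intro continuous_on_tmult continuous_on_id column_cont)
    show "a + (\<Sum>j\<in>UNIV. v $ j *\<^sub>R G j a) \<in> lie_grp N" if "a \<in> lie_grp N" for a v
      using that G_in by (intro sum_lie_alg_in_lie_grp)
    show "1 + hsum N (a + (\<Sum>j\<in>UNIV. v $ j *\<^sub>R G j a)) \<le> (1 + c * norm v) * (1 + hsum N a)"
      if a: "a \<in> lie_grp N" and v: "norm v \<le> L * T" for a v
    proof -
      have "hsum N (a + (\<Sum>j\<in>UNIV. v $ j *\<^sub>R G j a)) \<le> hsum N a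
          + real (card (words N :: 'm list set)) * hdeg N * (1 + E * (L * T)) ^ hdeg N * (E * norm v) * (1 + hsum N a)"
        using E v by (intro hsum_add_le a incr_le mult_left_mono) auto
      then show ?thesis by (simp add: c_def algebra_simps)
    qed
  qed (auto simp: T x S0 hsum_nonneg add_nonneg_nonneg)
  show ?thesis using exists_solution unfolding cde_solution_def G_def .
qed

section \<open>Reduction of the two growth hypotheses to coordinate bounds\<close>

lemma hnorm_trunc_le:
  fixes a :: "'m::finite tensor"
  assumes "n \<le> N"
  shows "hnorm n (trunc n a) \<le> real (card (words n :: 'm list set)) * hnorm N a"
proof -
  let ?c = "real (card (words n :: 'm list set))"
  have "[] \<in> (words n :: 'm list set)" by (simp add: words_def)
  then have "0 < card (words n :: 'm list set)" by (auto simp: card_gt_0_iff)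
  then have c: "1 \<le> ?c" by simp
  have "\<bar>tcoeff (trunc n a) w\<bar> \<le> hnorm N a ^ length w" if "w \<in> words n - {[]}" for w
    using that assms tcoeff_le_hnorm[of w N a] by (auto simp: words_def)
  then have "hsum n (trunc n a) \<le> ?c * hnorm N a ^ hdeg n"
    by (intro hsum_le hnorm_nonneg)
  \<comment> \<open>Weakening the count to its \<open>hdeg n\<close>-th power turns the right-hand
    side into a perfect power, from which the root can be taken.\<close>
  also have "\<dots> \<le> ?c ^ hdeg n * hnorm N a ^ hdeg n"
    using c hdeg_pos[of n] hnorm_nonneg[of N a] by (intro mult_right_mono self_le_power) auto
  also have "\<dots> = (?c * hnorm N a) ^ hdeg n" by (simp add: power_mult_distrib)
  finally have "hnorm n (trunc n a) ^ hdeg n \<le> (?c * hnorm N a) ^ hdeg n" by (simp add: hnorm_power)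
  then show ?thesis
    by (rule power_mono_iff[THEN iffD1, rotated 3]) (auto simp: hnorm_nonneg hdeg_pos)
qed

lemma abs_tcoeff_le_norm_level: "\<bar>tcoeff a w\<bar> \<le> norm (level (length w) a)"
  using abs_tcoeff_le_norm[of "level (length w) a" w] by simp

theorem theorem4p30:
  fixes T :: real
    and N :: nat
    and x :: "real \<Rightarrow> real ^ 'd"
    and S0 :: "'m::finite tensor"
    and F :: "'m tensor \<Rightarrow> (real ^ 'd) \<Rightarrow>\<^sub>L 'm tensor"
    and h :: "nat \<Rightarrow> 'm tensor \<Rightarrow> real"
  assumes T: "T > 0"
    and x: "\<exists>L. L-lipschitz_on {0..T} x"
    and S0: "S0 \<in> lie_grp N"
    and F_cont: "continuous_on (lie_grp N) F"
    and F_range: "\<And>a v. a \<in> lie_grp N \<Longrightarrow> blinfun_apply (F a) v \<in> lie_alg N"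
    and gauge: "\<And>n. n \<le> N \<Longrightarrow> homogeneous_gauge n (h n)"
  shows
    "((\<exists>C>0. \<forall>a\<in>lie_grp N. \<forall>j. lie_gauge N (h N) (blinfun_column F j a) \<le> C * (1 + h N a))
        \<longrightarrow> (\<exists>S. cde_solution N F x S0 T S)) \<and>
     (levelwise_triangular N F \<and>
      (\<exists>C>0. \<forall>a\<in>lie_grp N. \<forall>j. \<forall>n\<in>{1..N}.
         norm (level n (blinfun_column F j a)) \<le> C * (1 + h n (trunc n a)))
        \<longrightarrow> (\<exists>S. cde_solution N F x S0 T S))"
proof (intro conjI impI)
  obtain L where L: "L-lipschitz_on {0..T} x" using x by blast
  note solution = cde_solution_exists[OF T L S0 F_cont F_range]
  {
    assume "\<exists>C>0. \<forall>a\<in>lie_grp N. \<forall>j. lie_gauge N (h N) (blinfun_column F j a) \<le> C * (1 + h N a)"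
    then obtain C where C: "0 < C"
      "\<And>a j. a \<in> lie_grp N \<Longrightarrow> lie_gauge N (h N) (blinfun_column F j a) \<le> C * (1 + h N a)" by blast
    obtain C1 where C1: "0 \<le> C1" "\<And>g. g \<in> lie_grp N \<Longrightarrow> h N g \<le> C1 * hnorm N g"
      using gauge_le_hnorm[OF gauge[OF order_refl]] by blast
    obtain C2 where C2: "0 < C2" "\<And>b. b \<in> lie_alg N \<Longrightarrow> hnorm N b \<le> C2 * lie_gauge N (h N) b"
      using hnorm_le_lie_gauge[OF gauge[OF order_refl]] by blast
    \<comment> \<open>The lower bound 1 allows \<open>D ^ length w\<close> to be replaced by
      \<open>D ^ N\<close>.\<close>
    define D where "D = max 1 (C2 * C * (1 + C1))"
    have "\<bar>tcoeff (blinfun_column F j a) w\<bar> \<le> D ^ N * (1 + hnorm N a) ^ length w"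
      if a: "a \<in> lie_grp N" and w: "w \<in> words N - {[]}" for a j w
    proof -
      let ?b = "blinfun_column F j a"
      have b: "?b \<in> lie_alg N" unfolding blinfun_column_def using F_range[OF a] .
      have "hnorm N ?b \<le> C2 * (C * (1 + C1 * hnorm N a))"
        using C(2)[OF a, of j] C1(2)[OF a] C(1) C2(1)
        by (intro order_trans[OF C2(2)[OF b]] mult_left_mono order_trans[OF C(2)[OF a]]) auto
      also have "\<dots> \<le> C2 * (C * ((1 + C1) * (1 + hnorm N a)))"
        using C(1) C1(1) C2(1) hnorm_nonneg[of N a] by (intro mult_left_mono) (auto simp: algebra_simps)
      also have "\<dots> \<le> D * (1 + hnorm N a)"
        using hnorm_nonneg[of N a] mult_right_mono[of "C2 * C * (1 + C1)" D "1 + hnorm N a"]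
        by (simp add: D_def mult.assoc)
      finally have le: "hnorm N ?b \<le> D * (1 + hnorm N a)" .
      have "\<bar>tcoeff ?b w\<bar> \<le> hnorm N ?b ^ length w" using tcoeff_le_hnorm[OF w] .
      also have "\<dots> \<le> D ^ length w * (1 + hnorm N a) ^ length w"
        using power_mono[OF le hnorm_nonneg] by (simp add: power_mult_distrib)
      also have "\<dots> \<le> D ^ N * (1 + hnorm N a) ^ length w"
        using w hnorm_nonneg[of N a]
        by (intro mult_right_mono power_increasing) (auto simp: D_def words_def)
      finally show ?thesis .
    qed
    then show "\<exists>S. cde_solution N F x S0 T S"
      by (rule solution[rotated 2]) (auto simp: D_def)
  next
    assume "levelwise_triangular N F \<and> (\<exists>C>0. \<forall>a\<in>lie_grp N. \<forall>j. \<forall>n\<in>{1..N}.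
         norm (level n (blinfun_column F j a)) \<le> C * (1 + h n (trunc n a)))"
    then obtain C where C: "0 < C"
      "\<And>a j n. a \<in> lie_grp N \<Longrightarrow> n \<in> {1..N} \<Longrightarrow>
        norm (level n (blinfun_column F j a)) \<le> C * (1 + h n (trunc n a))" by blast
    have "\<exists>K\<ge>0. \<forall>g\<in>lie_grp n. h n g \<le> K * hnorm n g" if "n \<le> N" for n
      using gauge_le_hnorm[OF gauge[OF that]] by metis
    then obtain K where K: "\<And>n. n \<le> N \<Longrightarrow> 0 \<le> K n"
      "\<And>n g. n \<le> N \<Longrightarrow> g \<in> lie_grp n \<Longrightarrow> h n g \<le> K n * hnorm n g" by metis
    define M where "M n = K n * real (card (words n :: 'm list set))" for n
    \<comment> \<open>The sum dominates the gauge constants of all levels at once.\<close>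
    define D where "D = C * (1 + (\<Sum>n\<le>N. M n))"
    have M: "0 \<le> M n" if "n \<le> N" for n using K(1)[OF that] by (simp add: M_def)
    have D: "0 \<le> D" using C(1) M by (auto simp: D_def intro!: mult_nonneg_nonneg add_nonneg_nonneg sum_nonneg)
    have "\<bar>tcoeff (blinfun_column F j a) w\<bar> \<le> D * (1 + hnorm N a) ^ length w"
      if a: "a \<in> lie_grp N" and w: "w \<in> words N - {[]}" for a j w
    proof -
      define n where "n = length w"
      have n: "n \<in> {1..N}" using w by (auto simp: n_def words_def Suc_le_eq)
      have "trunc n a \<in> lie_grp n" using a by (auto simp: lie_grp_def trunc_tensors_iff)
      then have "h n (trunc n a) \<le> K n * hnorm n (trunc n a)" using n by (intro K(2)) auto
      also have "\<dots> \<le> M n * hnorm N a"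
        using mult_left_mono[OF hnorm_trunc_le[of n N a] K(1)[of n]] n by (simp add: M_def mult.assoc)
      also have "\<dots> \<le> (\<Sum>n\<le>N. M n) * hnorm N a"
        using n M hnorm_nonneg[of N a] by (intro mult_right_mono member_le_sum) auto
      finally have h: "h n (trunc n a) \<le> (\<Sum>n\<le>N. M n) * hnorm N a" .
      have M_sum: "0 \<le> (\<Sum>n\<le>N. M n)" using M by (intro sum_nonneg) auto
      have "\<bar>tcoeff (blinfun_column F j a) w\<bar> \<le> norm (level n (blinfun_column F j a))"
        unfolding n_def by (rule abs_tcoeff_le_norm_level)
      also have "\<dots> \<le> C * (1 + h n (trunc n a))" using a n by (rule C(2))
      also have "\<dots> \<le> C * ((1 + (\<Sum>n\<le>N. M n)) * (1 + hnorm N a))"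
        using h M_sum hnorm_nonneg[of N a] C(1) by (intro mult_left_mono) (auto simp: algebra_simps)
      also have "\<dots> = D * (1 + hnorm N a) ^ 1" by (simp add: D_def)
      \<comment> \<open>The linear bound is weaker than required only at first sight: the base is at
        least 1 and \<open>length w\<close> is at least 1, so it implies the power bound.\<close>
      also have "\<dots> \<le> D * (1 + hnorm N a) ^ length w"
        using D n hnorm_nonneg[of N a] by (intro mult_left_mono power_increasing) (auto simp: n_def)
      finally show ?thesis .
    qed
    with D show "\<exists>S. cde_solution N F x S0 T S" by (intro solution) auto
  }
qed

end
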